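(* Let $n\ge 4$ and let $\{F^{ij}\}_{1\le i<j\le n}$ be a complete set of $\binom{n}{2}$ real fundamental matrices such that for all distinct $i,j,k,l$ the sextuple $F^{ij},F^{ik},F^{jk},F^{il},F^{jl},F^{kl}$ is compatible. Then $\{F^{ij}\}$ is compatible. Moreover, if in each image all epipoles coincide (for each $i$, the epipoles $e_i^j$, $j\neq i$, are all equal as points of $\mathbb{P}^2$), then triple-wise compatibility (compatibility of $\{F^{ij},F^{ik},F^{jk}\}$ for all distinct $i,j,k$) implies that $\{F^{ij}\}$ is compatible, and the reconstruction (solution) in this case is a set of cameras whose centers all lie on a line.
   Context: Everything is over $\mathbb{R}$. A camera is a rank-3 real $3\times 4$ matrix (up to nonzero scale); its center is its kernel, a point of $\mathbb{P}^3$. A fundamental matrix is a rank-2 real $3\times 3$ matrix (up to nonzero scale). For $3\times 4$ matrices $P_1,P_2$, $\psi(P_1,P_2)$ is the $3\times3$ matrix $F$ (up to scale) with $\det\begin{bmatrix}P_1&x&0\\P_2&0&y\end{bmatrix}=x^TFy$ for all $x,y\in\mathbb{R}^3$. Convention: $F^{ji}=(F^{ij})^T$. A set $\{F^{ij}\}$ is compatible if there are cameras $P_i$, one for each index occurring, with $F^{ij}=\psi(P_i,P_j)$ up to nonzero scale for all given $(i,j)$; such cameras are called a solution (or reconstruction). The epipole $e_j^i$ (the $i$-th epipole in the $j$-th image) is a vector spanning $\ker F^{ij}$, viewed as a point of $\mathbb{P}^2$. *)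

theory Defs
  imports "HOL-Analysis.Analysis"
begin

definition camera :: "real^4^3 \<Rightarrow> bool"
  where "camera P \<longleftrightarrow> rank P = 3"

definition fundamental_matrix :: "real^3^3 \<Rightarrow> bool"
  where "fundamental_matrix F \<longleftrightarrow> rank F = 2"

(* A point of a projective space is represented by the corresponding
   one-dimensional linear subspace, a line of P^3 by a two-dimensional one. *)

definition center :: "real^4^3 \<Rightarrow> (real^4) set"
  where "center P = {v. P *v v = 0}"

definition projective_line :: "(real^4) set \<Rightarrow> bool"
  where "projective_line L \<longleftrightarrow> subspace L \<and> dim L = 2"

definition equal_up_to_scale :: "real^3^3 \<Rightarrow> real^3^3 \<Rightarrow> bool"
  where "equal_up_to_scale A B \<longleftrightarrow> (\<exists>c. c \<noteq> 0 \<and> A = c *\<^sub>R B)"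

(* The block matrix with rows [P x 0] and [Q 0 y]. *)
definition two_view_matrix ::
    "real^4^3 \<Rightarrow> real^4^3 \<Rightarrow> real^3 \<Rightarrow> real^3 \<Rightarrow> real^6^6"
  where "two_view_matrix P Q x y = vector
    [vector [P$1$1, P$1$2, P$1$3, P$1$4, x$1, 0],
     vector [P$2$1, P$2$2, P$2$3, P$2$4, x$2, 0],
     vector [P$3$1, P$3$2, P$3$3, P$3$4, x$3, 0],
     vector [Q$1$1, Q$1$2, Q$1$3, Q$1$4, 0, y$1],
     vector [Q$2$1, Q$2$2, Q$2$3, Q$2$4, 0, y$2],
     vector [Q$3$1, Q$3$2, Q$3$3, Q$3$4, 0, y$3]]"

definition psi :: "real^4^3 \<Rightarrow> real^4^3 \<Rightarrow> real^3^3"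
  where "psi P Q = (THE F. \<forall>x y. det (two_view_matrix P Q x y) = x \<bullet> (F *v y))"

lemma exhaust_6: "x = 1 \<or> x = 2 \<or> x = 3 \<or> x = 4 \<or> x = 5 \<or> x = 6" for x :: 6
proof (induct x)
  case (of_int z)
  then have "z = 0 \<or> z = 1 \<or> z = 2 \<or> z = 3 \<or> z = 4 \<or> z = 5" by fastforce
  then show ?case by auto
qed

lemma forall_6: "(\<forall>i::6. P i) \<longleftrightarrow> P 1 \<and> P 2 \<and> P 3 \<and> P 4 \<and> P 5 \<and> P 6"
  by (metis exhaust_6)

lemma vector_6:
  fixes a b c d e f :: "'a::zero"
  shows "(vector [a,b,c,d,e,f] :: 'a^6)$1 = a"
    "(vector [a,b,c,d,e,f] :: 'a^6)$2 = b"
    "(vector [a,b,c,d,e,f] :: 'a^6)$3 = c"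
    "(vector [a,b,c,d,e,f] :: 'a^6)$4 = d"
    "(vector [a,b,c,d,e,f] :: 'a^6)$5 = e"
    "(vector [a,b,c,d,e,f] :: 'a^6)$6 = f"
  unfolding vector_def by simp_all

lemma linear_det_row:
  fixes f :: "real^'m \<Rightarrow> real^'n"
  assumes "linear f"
  shows "linear (\<lambda>x. det (\<chi> i. if i = k then f x else C i))"
proof (rule linearI)
  show "det (\<chi> i. if i = k then f (x + y) else C i) =
      det (\<chi> i. if i = k then f x else C i) + det (\<chi> i. if i = k then f y else C i)" for x y
    unfolding linear_add[OF assms] by (rule det_row_add)
  show "det (\<chi> i. if i = k then f (r *\<^sub>R x) else C i) =
      r *\<^sub>R det (\<chi> i. if i = k then f x else C i)" for r x
    unfolding linear_scale[OF assms] real_scaleR_def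
    unfolding scalar_mult_eq_scaleR[symmetric] by (rule det_row_mul)
qed

lemma linear_two_view_left: "linear (\<lambda>x. det (two_view_matrix P Q x y))"
proof -
  let ?f = "\<lambda>x::real^3. vector [x$1, x$2, x$3, 0, 0, 0] :: real^6"
  let ?C = "\<lambda>i. row i (transpose (two_view_matrix P Q 0 y))"
  have f: "linear ?f"
    by (rule linearI) (simp_all add: vec_eq_iff forall_6 vector_6)
  have eq: "transpose (two_view_matrix P Q x y) = (\<chi> i. if i = 5 then ?f x else ?C i)" for x
    by (simp add: two_view_matrix_def transpose_def row_def vec_eq_iff forall_6 vector_6)
  show ?thesis
    using linear_det_row[OF f, of 5 ?C] by (simp flip: eq add: det_transpose)
qed

lemma linear_two_view_right: "linear (\<lambda>y. det (two_view_matrix P Q x y))"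
proof -
  let ?f = "\<lambda>y::real^3. vector [0, 0, 0, y$1, y$2, y$3] :: real^6"
  let ?C = "\<lambda>i. row i (transpose (two_view_matrix P Q x 0))"
  have f: "linear ?f"
    by (rule linearI) (simp_all add: vec_eq_iff forall_6 vector_6)
  have eq: "transpose (two_view_matrix P Q x y) = (\<chi> i. if i = 6 then ?f y else ?C i)" for y
    by (simp add: two_view_matrix_def transpose_def row_def vec_eq_iff forall_6 vector_6)
  show ?thesis
    using linear_det_row[OF f, of 6 ?C] by (simp flip: eq add: det_transpose)
qed

lemma ex1_psi: "\<exists>!F. \<forall>x y. det (two_view_matrix P Q x y) = x \<bullet> (F *v y)"
proof (rule ex_ex1I)
  let ?B = "\<lambda>x y. det (two_view_matrix P Q x y)"
  let ?F = "(\<chi> i j. ?B (axis i 1) (axis j 1)) :: real^3^3"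
  have "?B x y = x \<bullet> (?F *v y)" for x y
  proof -
    have "?B x y = ?B (\<Sum>i\<in>UNIV. x$i *\<^sub>R axis i 1) (\<Sum>j\<in>UNIV. y$j *\<^sub>R axis j 1)"
      using basis_expansion[of x] basis_expansion[of y] by (simp add: scalar_mult_eq_scaleR)
    also have "\<dots> = (\<Sum>i\<in>UNIV. x$i * (\<Sum>j\<in>UNIV. y$j * ?B (axis i 1) (axis j 1)))"
      unfolding linear_sum[OF linear_two_view_left] linear_scale[OF linear_two_view_left]
      unfolding linear_sum[OF linear_two_view_right] linear_scale[OF linear_two_view_right]
      by simp
    also have "\<dots> = x \<bullet> (?F *v y)"
      by (simp add: inner_vec_def matrix_vector_mult_def mult.commute)
    finally show ?thesis .
  qed
  then show "\<exists>F. \<forall>x y. ?B x y = x \<bullet> (F *v y)" by blast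
next
  fix F G :: "real^3^3"
  assume "\<forall>x y. det (two_view_matrix P Q x y) = x \<bullet> (F *v y)"
    and "\<forall>x y. det (two_view_matrix P Q x y) = x \<bullet> (G *v y)"
  then have "x \<bullet> (F *v y) = x \<bullet> (G *v y)" for x y by metis
  then have "F *v y = G *v y" for y by (metis vector_eq_ldot)
  then show "F = G" by (simp add: matrix_eq)
qed

lemma psi: "det (two_view_matrix P Q x y) = x \<bullet> (psi P Q *v y)"
  using theI'[OF ex1_psi[of P Q]] unfolding psi_def by blast

(* E is the set of index pairs (i, j) for which F i j is given; Field E is the
   set of indices that occur. Only the values of F on E matter. *)
definition solution ::
    "(nat \<times> nat) set \<Rightarrow> (nat \<Rightarrow> nat \<Rightarrow> real^3^3) \<Rightarrow> (nat \<Rightarrow> real^4^3) \<Rightarrow> bool"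
  where "solution E F P \<longleftrightarrow>
    (\<forall>i\<in>Field E. camera (P i)) \<and>
    (\<forall>(i, j)\<in>E. equal_up_to_scale (F i j) (psi (P i) (P j)))"

definition compatible :: "(nat \<times> nat) set \<Rightarrow> (nat \<Rightarrow> nat \<Rightarrow> real^3^3) \<Rightarrow> bool"
  where "compatible E F \<longleftrightarrow> (\<exists>P. solution E F P)"

definition complete_pairs :: "nat \<Rightarrow> (nat \<times> nat) set"
  where "complete_pairs n = {(i, j). 1 \<le> i \<and> i < j \<and> j \<le> n}"

(* epipole F i j is the i-th epipole in the j-th image. *)
definition epipole :: "(nat \<Rightarrow> nat \<Rightarrow> real^3^3) \<Rightarrow> nat \<Rightarrow> nat \<Rightarrow> (real^3) set"
  where "epipole F i j = {v. F i j *v v = 0}"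

end

theory Submission
  imports Defs
begin

text \<open>
  For cameras \<open>P\<close>, \<open>Q\<close> and a fundamental matrix \<open>F\<close>, \<open>F\<close> is proportional to \<open>psi P Q\<close> iff the
  centers differ and \<open>(P X) \<bullet> (F (Q X))\<close> vanishes identically. The skew forms on \<open>\<real>\<^sup>4\<close> that have both
  centers in their radical form a line; hence a second camera is determined by \<open>F\<close> and the first one
  up to scale and up to adding \<open>X \<mapsto> (w \<bullet> X) e\<close> with \<open>e\<close> the epipole. So two views are determined up
  to projective transformations, and so are three views with noncollinear centers.

  If some image \<open>i\<close> has two distinct epipoles, coming from \<open>j\<close> and \<open>k\<close>, then \<open>i, j, k\<close> have noncollinear
  centers in every reconstruction. Fix their reconstruction; the quadruples \<open>i, j, k, l\<close> then yield
  all other cameras. For two further indices \<open>l\<close>, \<open>m\<close> some side \<open>a, b\<close> of the triangle contains neither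
  of their centers, and the quadruple \<open>a, b, l, m\<close> shows that the cameras \<open>l\<close> and \<open>m\<close> match \<open>F l m\<close>.

  If all epipoles in each image coincide, cameras with centers on a fixed line can be written down
  explicitly from the matrices \<open>F i b\<close> for one fixed \<open>b\<close>; the condition for the pair \<open>i, j\<close> involves
  only the triple \<open>b, i, j\<close>.
\<close>

unbundle cross3_syntax

section \<open>Kernels and skew forms\<close>

text \<open>The kernel is the orthogonal complement of the row space, so its dimension is the number
  of columns minus the rank, here 1. It serves both for centers of cameras and for epipoles.\<close>

lemma kernel_spanned_by_vector:
  fixes A :: "real^'n^'m"
  assumes "rank A + 1 = CARD('n)"
  obtains c where "c \<noteq> 0" "A *v c = 0" "\<And>v. A *v v = 0 \<Longrightarrow> \<exists>a. v = a *\<^sub>R c"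
proof -
  let ?K = "{v. A *v v = 0}"
  have K: "?K = {v \<in> UNIV. \<forall>r\<in>span (rows A). orthogonal r v}"
  proof -
    have "A *v v = 0 \<longleftrightarrow> (\<forall>r\<in>span (rows A). orthogonal r v)" for v
    proof
      assume "A *v v = 0"
      then show "\<forall>r\<in>span (rows A). orthogonal r v"
        using orthogonal_nullspace_rowspace orthogonal_commute by blast
    next
      assume "\<forall>r\<in>span (rows A). orthogonal r v"
      then have "orthogonal (row i A) v" for i
        by (auto simp: rows_def intro: span_base)
      then show "A *v v = 0"
        by (simp add: vec_eq_iff matrix_vector_mul_component orthogonal_def row_def)
    qed
    then show ?thesis by auto
  qed
  have sub: "subspace ?K"
    by (simp add: subspace_def matrix_vector_right_distrib scaleR_matrix_vector_assoc[symmetric] matrix_vector_mult_scaleR)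
  have "dim ?K + dim (rows A) = dim (UNIV :: (real^'n) set)"
    unfolding K
    using dim_subspace_orthogonal_to_vectors[of "span (rows A)" UNIV] by simp
  then have d: "dim ?K = 1"
    using assms by (simp add: row_rank_def)
  then obtain c where c: "c \<in> ?K" "c \<noteq> 0"
    by (metis (no_types, lifting) dim_eq_0 insertCI subsetI zero_neq_one)
  have "span {c} = ?K"
    using c d sub by (intro subspace_dim_equal) (auto intro: span_minimal simp: span_minimal)
  then show thesis
    using that[of c] c by (auto simp: span_singleton)
qed

lemma camera_surj: "camera P \<Longrightarrow> \<exists>X. P *v X = y"
  using full_rank_surjective[of P] unfolding camera_def by (simp add: surj_def) metis

lemma cameraI: "(\<And>y. \<exists>X. P *v X = y) \<Longrightarrow> camera P"
  using full_rank_surjective[of P] unfolding camera_def by (simp add: surj_def) metis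

lemma camera_kernel:
  assumes "camera P"
  obtains c where "c \<noteq> 0" "P *v c = 0" "\<And>v. P *v v = 0 \<Longrightarrow> \<exists>a. v = a *\<^sub>R c"
  using kernel_spanned_by_vector[of P] assms unfolding camera_def by auto

lemma fundamental_kernel:
  assumes "fundamental_matrix F"
  obtains e where "e \<noteq> 0" "F *v e = 0" "\<And>v. F *v v = 0 \<Longrightarrow> \<exists>a. v = a *\<^sub>R e"
  using kernel_spanned_by_vector[of F] assms unfolding fundamental_matrix_def by auto

lemma camera_kernel_multiple:
  assumes "camera P" "P *v c = 0" "c \<noteq> 0" "P *v v = 0"
  obtains a where "v = a *\<^sub>R c"
proof -
  obtain k where k: "\<And>v. P *v v = 0 \<Longrightarrow> \<exists>a. v = a *\<^sub>R k"
    using camera_kernel[OF assms(1)] by metis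
  obtain x y where "c = x *\<^sub>R k" "v = y *\<^sub>R k"
    using k assms by metis
  then have "v = (y / x) *\<^sub>R c"
    using assms(3) by simp
  then show thesis by (rule that)
qed

lemma fundamental_kernel_multiple:
  assumes "fundamental_matrix F" "F *v e = 0" "e \<noteq> 0" "F *v v = 0"
  obtains a where "v = a *\<^sub>R e"
proof -
  obtain k where k: "\<And>v. F *v v = 0 \<Longrightarrow> \<exists>a. v = a *\<^sub>R k"
    using fundamental_kernel[OF assms(1)] by metis
  obtain x y where "e = x *\<^sub>R k" "v = y *\<^sub>R k"
    using k assms by metis
  then have "v = (y / x) *\<^sub>R e"
    using assms(3) by simp
  then show thesis by (rule that)
qed

lemma fundamental_transpose: "fundamental_matrix (transpose F) \<longleftrightarrow> fundamental_matrix F"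
  by (simp add: fundamental_matrix_def rank_transpose)

lemma dot_transpose: "x \<bullet> (A *v y) = (transpose A *v x) \<bullet> y" for A :: "real^'n^'m"
  by (metis dot_lmul_matrix transpose_matrix_vector)

text \<open>Polarisation makes \<open>M\<close> antisymmetric; its three free entries are the
  coordinates of the axis of a cross product.\<close>

lemma skew_matrix_3:
  fixes M :: "real^3^3"
  assumes "\<And>x. x \<bullet> (M *v x) = 0"
  obtains m where "\<And>x. M *v x = m \<times> x"
proof -
  have *: "x \<bullet> (M *v y) + y \<bullet> (M *v x) = 0" for x y
    using assms[of x] assms[of y] assms[of "x + y"]
    by (simp add: matrix_vector_right_distrib inner_add_left inner_add_right)
  have "M$i$j + M$j$i = 0" for i j
    using *[of "axis i 1" "axis j 1"]
    by (simp add: inner_axis' matrix_vector_mul_component inner_axis)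
  then have "M$1$1 = 0" "M$2$2 = 0" "M$3$3 = 0" "M$2$1 = - M$1$2" "M$3$1 = - M$1$3" "M$3$2 = - M$2$3"
    by (smt (verit))+
  then have "M *v x = vector [M$3$2, M$1$3, M$2$1] \<times> x" for x
    by (simp add: matrix_vector_mult_def cross3_def vec_eq_iff forall_3 sum_3 algebra_simps)
  then show thesis by (rule that)
qed

text \<open>Polarisation shows that \<open>M\<close> kills the kernel of \<open>P\<close>, so
  \<open>M\<close> factors through \<open>P\<close>. With \<open>R\<close> a right inverse of
  \<open>P\<close>, the factor \<open>M ** R\<close> is a skew form on the image space, hence a
  cross product.\<close>

lemma skew_along_camera:
  fixes M :: "real^4^3"
  assumes P: "camera P" and skew: "\<And>X. (P *v X) \<bullet> (M *v X) = 0"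
  obtains m where "\<And>X. M *v X = m \<times> (P *v X)"
proof -
  have pol: "(P *v X) \<bullet> (M *v Y) + (P *v Y) \<bullet> (M *v X) = 0" for X Y
    using skew[of X] skew[of Y] skew[of "X + Y"]
    by (simp add: matrix_vector_right_distrib inner_add_left inner_add_right)
  have ker: "M *v c = 0" if "P *v c = 0" for c
  proof -
    have "(P *v X) \<bullet> (M *v c) = 0" for X
      using pol[of X c] that by simp
    then show ?thesis
      by (metis P camera_surj inner_eq_zero_iff)
  qed
  obtain R :: "real^3^4" where R: "P ** R = mat 1"
    by (metis P camera_surj matrix_right_invertible_surjective surjI surj_def)
  have PR: "P *v (R *v x) = x" for x
    by (simp add: R matrix_vector_mul_assoc)
  have "x \<bullet> ((M ** R) *v x) = 0" for x
    using skew[of "R *v x"] by (simp add: PR flip: matrix_vector_mul_assoc)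
  then obtain m where m: "\<And>x. (M ** R) *v x = m \<times> x"
    using skew_matrix_3[of "M ** R"] by metis
  have "M *v X = m \<times> (P *v X)" for X
  proof -
    have "M *v (X - R *v (P *v X)) = 0"
      by (rule ker) (simp add: PR matrix_vector_mult_diff_distrib)
    then show ?thesis
      by (simp add: matrix_vector_mult_diff_distrib m[symmetric] flip: matrix_vector_mul_assoc)
  qed
  then show thesis by (rule that)
qed

lemma cross_eq_0_parallel:
  assumes "m \<times> p = 0" "p \<noteq> 0"
  obtains a where "m = a *\<^sub>R p"
proof -
  have "collinear {0, p, m}"
    using assms(1) cross_eq_0[of m p] by (simp add: insert_commute)
  then show thesis
    using that assms(2) collinear_lemma[of p m] by (metis scaleR_zero_left)
qed

lemma camera_equivalent:
  assumes "camera P" "camera Q"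
  obtains H :: "real^4^4" where "invertible H" "P ** H = Q"
proof -
  obtain c where c: "c \<noteq> 0" "P *v c = 0"
    using camera_kernel[OF assms(1)] by metis
  obtain k where k: "k \<noteq> 0" "Q *v k = 0" "\<And>v. Q *v v = 0 \<Longrightarrow> \<exists>a. v = a *\<^sub>R k"
    using camera_kernel[OF assms(2)] by metis
  obtain R :: "real^3^4" where R: "P ** R = mat 1"
    by (metis assms(1) camera_surj matrix_right_invertible_surjective surjI surj_def)
  \<comment> \<open>The first summand lifts \<open>Q X\<close> through the right inverse of
    \<open>P\<close>. The second lies in the kernel of \<open>P\<close>, so it does not disturb
    this, and it is nonzero on the kernel of \<open>Q\<close>, which makes \<open>h\<close>
    injective.\<close>
  define h where "h X = R *v (Q *v X) + (k \<bullet> X) *\<^sub>R c" for X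
  have "linear h"
    unfolding h_def by (rule linearI) (simp_all add: algebra_simps matrix_vector_right_distrib matrix_vector_mult_scaleR inner_add_right)
  then have H: "matrix h *v X = h X" for X
    by (simp add: matrix_works linear_matrix_vector_mul_eq)
  have PH: "P *v h X = Q *v X" for X
    by (simp add: h_def matrix_vector_right_distrib matrix_vector_mult_scaleR c matrix_vector_mul_assoc matrix_mul_assoc R)
  have "X = 0" if "h X = 0" for X
  proof -
    have "Q *v X = 0" using PH[of X] that by simp
    then obtain a where a: "X = a *\<^sub>R k" using k by blast
    then show ?thesis
      using that \<open>Q *v X = 0\<close> c k by (simp add: h_def)
  qed
  then have "invertible (matrix h)"
    by (metis H invertible_left_inverse matrix_left_invertible_ker)
  moreover have "P ** matrix h = Q"
    by (simp add: matrix_eq H PH flip: matrix_vector_mul_assoc)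
  ultimately show thesis by (rule that)
qed

section \<open>Two views\<close>

text \<open>The epipolar constraint for all scene points, with a common center excluded because
  \<open>psi\<close> would then be zero. Scalings and projective transformations act on this form
  directly, without determinants.\<close>

definition view_pair :: "real^3^3 \<Rightarrow> real^4^3 \<Rightarrow> real^4^3 \<Rightarrow> bool"
  where "view_pair F P Q \<longleftrightarrow>
    (\<forall>X. (P *v X) \<bullet> (F *v (Q *v X)) = 0) \<and> (\<forall>X. P *v X = 0 \<longrightarrow> Q *v X = 0 \<longrightarrow> X = 0)"

lemma view_pairD:
  assumes "view_pair F P Q"
  shows "(P *v X) \<bullet> (F *v (Q *v X)) = 0" "P *v X = 0 \<Longrightarrow> Q *v X = 0 \<Longrightarrow> X = 0"
  using assms by (auto simp: view_pair_def)

lemma view_pair_transpose: "view_pair F P Q \<Longrightarrow> view_pair (transpose F) Q P"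
  unfolding view_pair_def by (metis dot_transpose inner_commute transpose_transpose)

lemma view_pair_compose:
  assumes "view_pair F P Q" "invertible H"
  shows "view_pair F (P ** H) (Q ** H)"
  using assms unfolding view_pair_def
  by (metis invertible_left_inverse matrix_left_invertible_ker matrix_vector_mul_assoc)

lemma view_pair_scale:
  assumes "s \<noteq> 0" "t \<noteq> 0"
  shows "view_pair F (s *\<^sub>R P) (t *\<^sub>R Q) \<longleftrightarrow> view_pair F P Q"
  using assms unfolding view_pair_def
  by (simp add: scaleR_matrix_vector_assoc[symmetric] matrix_vector_mult_scaleR)

lemma camera_compose:
  assumes "camera P" "invertible H"
  shows "camera (P ** H)"
proof -
  have "surj ((*v) H)"
    using assms(2) by (metis invertible_right_inverse matrix_right_invertible_surjective)
  then show ?thesis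
    using assms(1) full_rank_surjective[of P] full_rank_surjective[of "P ** H"]
    unfolding camera_def by (simp add: surj_def flip: matrix_vector_mul_assoc) metis
qed

text \<open>Moving \<open>X\<close> by \<open>c\<close> leaves \<open>P X\<close> fixed, so the
  constraint makes \<open>F *v (Q *v c)\<close> orthogonal to the range of \<open>P\<close>, which
  is the whole space.\<close>

lemma epipole_of_center:
  assumes "view_pair F P Q" "camera P" "P *v c = 0"
  shows "F *v (Q *v c) = 0"
proof -
  have "(P *v X) \<bullet> (F *v (Q *v c)) = 0" for X
    using view_pairD(1)[OF assms(1), of X] view_pairD(1)[OF assms(1), of "X + c"] assms(3)
    by (simp add: matrix_vector_right_distrib inner_add_right)
  then show ?thesis
    by (metis assms(2) camera_surj inner_eq_zero_iff)
qed

text \<open>Vanishing at \<open>d\<close> forces the axis of the cross product to be parallel to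
  \<open>P d\<close>, which leaves one scalar.\<close>

lemma skew_along_camera_kernel:
  fixes M :: "real^4^3"
  assumes "camera P" "\<And>X. (P *v X) \<bullet> (M *v X) = 0" "M *v d = 0" "P *v d \<noteq> 0"
  obtains a where "\<And>X. M *v X = a *\<^sub>R ((P *v d) \<times> (P *v X))"
proof -
  obtain m where m: "\<And>X. M *v X = m \<times> (P *v X)"
    using skew_along_camera[of P M] assms(1,2) by blast
  then obtain a where "m = a *\<^sub>R (P *v d)"
    using cross_eq_0_parallel[of m "P *v d"] assms(3,4) by metis
  then show thesis
    using that[of a] m by (simp add: cross_mult_left)
qed

text \<open>\<open>F ** Q\<close> is itself a skew form along \<open>P\<close> that vanishes at the
  center \<open>d\<close> of \<open>Q\<close>. All such forms are multiples of one cross product,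
  and \<open>F ** Q\<close> is nonzero, so it spans them.\<close>

lemma view_pair_form:
  assumes "camera P" "camera Q" "fundamental_matrix F" "view_pair F P Q"
  obtains d where "d \<noteq> 0" "Q *v d = 0" "P *v d \<noteq> 0" "transpose F *v (P *v d) = 0"
    "\<And>M :: real^4^3. (\<And>X. (P *v X) \<bullet> (M *v X) = 0) \<Longrightarrow> M *v d = 0 \<Longrightarrow>
      \<exists>r. \<forall>X. M *v X = r *\<^sub>R (F *v (Q *v X))"
proof -
  obtain d where d: "d \<noteq> 0" "Q *v d = 0"
    using camera_kernel[OF assms(2)] by metis
  have Pd: "P *v d \<noteq> 0"
    using view_pairD(2)[OF assms(4)] d by metis
  obtain a where a: "\<And>X. (F ** Q) *v X = a *\<^sub>R ((P *v d) \<times> (P *v X))"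
    using skew_along_camera_kernel[OF assms(1), of "F ** Q" d] view_pairD(1)[OF assms(4)] d Pd
    by (metis matrix_vector_mul_assoc matrix_vector_mult_0_right)
  have "a \<noteq> 0"
  proof
    assume "a = 0"
    then have "F *v (Q *v X) = 0" for X
      using a[of X] by (simp add: matrix_vector_mul_assoc)
    then have "F = 0"
      using camera_surj[OF assms(2)] by (simp add: matrix_eq) metis
    then show False
      using assms(3) by (simp add: fundamental_matrix_def)
  qed
  show thesis
  proof (rule that[OF d Pd])
    show "transpose F *v (P *v d) = 0"
      using epipole_of_center[OF view_pair_transpose[OF assms(4)] assms(2) d(2)] .
    fix M :: "real^4^3"
    assume "\<And>X. (P *v X) \<bullet> (M *v X) = 0" "M *v d = 0"
    then obtain b where b: "\<And>X. M *v X = b *\<^sub>R ((P *v d) \<times> (P *v X))"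
      using skew_along_camera_kernel[OF assms(1), of M d] Pd by metis
    have "M *v X = (b / a) *\<^sub>R (F *v (Q *v X))" for X
      using a[of X] b[of X] \<open>a \<noteq> 0\<close> by (simp add: matrix_vector_mul_assoc)
    then show "\<exists>r. \<forall>X. M *v X = r *\<^sub>R (F *v (Q *v X))" by blast
  qed
qed

text \<open>\<open>F ** Q'\<close> lies in the line of skew forms spanned by \<open>F ** Q\<close>,
  so \<open>Q' - r Q\<close> takes values in the kernel of \<open>F\<close>, which is spanned by the
  epipole \<open>Q c\<close>. \<open>Q'\<close> ranges over all matrices because one of lower rank
  will be inserted later.\<close>

lemma second_camera_freedom:
  fixes Q' :: "real^4^3"
  assumes "camera P" "camera Q" "fundamental_matrix F" "view_pair F P Q"
    and skew: "\<And>X. (P *v X) \<bullet> (F *v (Q' *v X)) = 0"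
    and c: "P *v c = 0" "c \<noteq> 0"
  obtains r w where "\<And>X. Q' *v X = r *\<^sub>R (Q *v X) + (w \<bullet> X) *\<^sub>R (Q *v c)"
proof -
  obtain d where d: "d \<noteq> 0" "Q *v d = 0" "P *v d \<noteq> 0" "transpose F *v (P *v d) = 0"
    and form: "\<And>M :: real^4^3. (\<And>X. (P *v X) \<bullet> (M *v X) = 0) \<Longrightarrow> M *v d = 0 \<Longrightarrow>
      \<exists>r. \<forall>X. M *v X = r *\<^sub>R (F *v (Q *v X))"
    using view_pair_form[OF assms(1-4)] by metis
  have pol: "(P *v X) \<bullet> (F *v (Q' *v Y)) + (P *v Y) \<bullet> (F *v (Q' *v X)) = 0" for X Y
    using skew[of X] skew[of Y] skew[of "X + Y"]
    by (simp add: matrix_vector_right_distrib inner_add_left inner_add_right)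
  have "(P *v X) \<bullet> (F *v (Q' *v d)) = 0" for X
    using pol[of X d] d(4) by (simp add: dot_transpose[of "P *v d"])
  then have "F *v (Q' *v d) = 0"
    by (metis assms(1) camera_surj inner_eq_zero_iff)
  then obtain r where r: "\<And>X. F *v (Q' *v X) = r *\<^sub>R (F *v (Q *v X))"
    using form[of "F ** Q'"] skew by (auto simp flip: matrix_vector_mul_assoc)
  define e where "e = Q *v c"
  have e: "e \<noteq> 0" "F *v e = 0"
    using view_pairD(2)[OF assms(4)] c epipole_of_center[OF assms(4,1)] by (auto simp: e_def)
  \<comment> \<open>The coordinate of \<open>Q' X - r (Q X)\<close> along \<open>e\<close>, found by
    orthogonal projection and written as a functional of \<open>X\<close>.\<close>
  define w where "w = (1 / (e \<bullet> e)) *\<^sub>R (transpose (Q' - r *\<^sub>R Q) *v e)"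
  have "Q' *v X = r *\<^sub>R (Q *v X) + (w \<bullet> X) *\<^sub>R e" for X
  proof -
    let ?v = "Q' *v X - r *\<^sub>R (Q *v X)"
    have "F *v ?v = 0"
      by (simp add: matrix_vector_mult_diff_distrib matrix_vector_mult_scaleR r)
    then obtain a where a: "?v = a *\<^sub>R e"
      using fundamental_kernel_multiple[OF assms(3) e(2,1)] by metis
    have "w \<bullet> X = (1 / (e \<bullet> e)) * (e \<bullet> ?v)"
      by (simp add: w_def dot_transpose[symmetric] dot_lmul_matrix matrix_vector_mult_diff_rdistrib scaleR_matrix_vector_assoc)
    then have "w \<bullet> X = a"
      using e(1) by (simp add: a)
    then show ?thesis using a by (simp add: algebra_simps)
  qed
  then show thesis unfolding e_def by (rule that)
qed

lemma second_camera_freedom_camera: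
  assumes "camera P" "camera Q" "camera Q'" "fundamental_matrix F" "view_pair F P Q" "view_pair F P Q'"
    and c: "P *v c = 0" "c \<noteq> 0"
  obtains r w where "r \<noteq> 0" "\<And>X. Q' *v X = r *\<^sub>R (Q *v X) + (w \<bullet> X) *\<^sub>R (Q *v c)"
proof -
  obtain r w where rw: "\<And>X. Q' *v X = r *\<^sub>R (Q *v X) + (w \<bullet> X) *\<^sub>R (Q *v c)"
    using second_camera_freedom[OF assms(1,2,4,5) view_pairD(1)[OF assms(6)] c] by metis
  \<comment> \<open>With \<open>r = 0\<close> the range of \<open>Q'\<close> would be at most a
    line, but a camera is onto.\<close>
  have "r \<noteq> 0"
  proof
    assume "r = 0"
    then have im: "Q' *v X \<in> span {Q *v c}" for X
      by (simp add: rw span_mul span_base)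
    have "span {Q *v c} = UNIV"
      using im camera_surj[OF assms(3)] by (metis UNIV_eq_I)
    then have "dim {Q *v c} = DIM(real^3)"
      by (metis dim_span dim_UNIV)
    then show False by (simp split: if_splits)
  qed
  then show thesis using that rw by blast
qed

text \<open>Once \<open>G\<close> has moved \<open>P\<close> to \<open>P'\<close>, both
  \<open>Q ** G\<close> and \<open>Q'\<close> are partners of \<open>P'\<close>. The remaining
  freedom between them is absorbed by a projective transformation that preserves \<open>P'\<close>
  up to scale.\<close>

lemma two_view_uniqueness:
  assumes "camera P" "camera Q" "camera P'" "camera Q'" "fundamental_matrix F"
    "view_pair F P Q" "view_pair F P' Q'"
  obtains H r where "invertible H" "r \<noteq> 0" "P' ** H = r *\<^sub>R P" "Q' ** H = Q"
proof -
  obtain G where G: "invertible G" "P ** G = P'"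
    using camera_equivalent[OF assms(1,3)] by metis
  obtain c where c: "c \<noteq> 0" "P' *v c = 0" "\<And>v. P' *v v = 0 \<Longrightarrow> \<exists>a. v = a *\<^sub>R c"
    using camera_kernel[OF assms(3)] by metis
  have vG: "view_pair F P' (Q ** G)"
    using view_pair_compose[OF assms(6) G(1)] G by simp
  have cG: "camera (Q ** G)"
    by (rule camera_compose[OF assms(2) G(1)])
  obtain r w where r: "r \<noteq> 0" and rw: "\<And>X. (Q ** G) *v X = r *\<^sub>R (Q' *v X) + (w \<bullet> X) *\<^sub>R (Q' *v c)"
    using second_camera_freedom_camera[OF assms(3,4) cG assms(5,7) vG c(2,1)] by metis
  \<comment> \<open>Adding a multiple of the center \<open>c\<close> of \<open>P'\<close> does not
    change the image under \<open>P'\<close>, while under \<open>Q'\<close> it produces exactly the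
    epipole term.\<close>
  define k where "k X = r *\<^sub>R X + (w \<bullet> X) *\<^sub>R c" for X
  have "linear k"
    unfolding k_def by (rule linearI) (simp_all add: algebra_simps inner_add_right)
  then have K: "matrix k *v X = k X" for X
    by (simp add: matrix_works linear_matrix_vector_mul_eq)
  have PK: "P' *v k X = r *\<^sub>R (P' *v X)" for X
    by (simp add: k_def matrix_vector_right_distrib matrix_vector_mult_scaleR c)
  have QK: "Q' *v k X = (Q ** G) *v X" for X
    by (simp add: k_def matrix_vector_right_distrib matrix_vector_mult_scaleR rw)
  have "X = 0" if "k X = 0" for X
  proof (rule view_pairD(2)[OF vG])
    show "P' *v X = 0" using PK[of X] that r by simp
    show "(Q ** G) *v X = 0" using QK[of X] that by simp
  qed
  then have iK: "invertible (matrix k)"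
    by (metis K invertible_left_inverse matrix_left_invertible_ker)
  have PK': "P' ** matrix k = r *\<^sub>R P'"
    by (simp add: matrix_eq K PK scaleR_matrix_vector_assoc flip: matrix_vector_mul_assoc)
  have QK': "Q' ** matrix k = Q ** G"
    using QK by (simp add: matrix_eq K flip: matrix_vector_mul_assoc)
  obtain G' where G': "G ** G' = mat 1" "G' ** G = mat 1"
    using G(1) by (auto simp: invertible_def)
  then have "invertible G'" by (auto simp: invertible_def)
  show thesis
  proof (rule that[OF _ r])
    show "invertible (matrix k ** G')"
      using iK \<open>invertible G'\<close> by (rule invertible_mult)
    show "P' ** (matrix k ** G') = r *\<^sub>R P"
      using G' by (metis PK' G(2) matrix_mul_assoc matrix_mul_rid scalar_matrix_assoc)
    show "Q' ** (matrix k ** G') = Q"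
      unfolding matrix_mul_assoc QK' by (simp add: G' flip: matrix_mul_assoc)
  qed
qed

section \<open>The kernel of the block matrix and its bilinear form \<open>psi\<close>\<close>

lemma singular_iff_kernel:
  fixes A :: "real^'n^'n"
  shows "det A = 0 \<longleftrightarrow> (\<exists>z. z \<noteq> 0 \<and> A *v z = 0)"
  using invertible_det_nz[of A] invertible_left_inverse[of A] matrix_left_invertible_ker[of A] by auto

lemma UNIV_6: "(UNIV :: 6 set) = {1, 2, 3, 4, 5, 6}"
  using exhaust_6 by auto

lemma sum_6: "(\<Sum>i\<in>(UNIV :: 6 set). f i) = f 1 + f 2 + f 3 + f 4 + f 5 + f 6"
  unfolding UNIV_6 by (simp add: ac_simps)

lemma vector_4_nth:
  "(vector [a,b,c,d] :: 'a::zero^4)$1 = a" "(vector [a,b,c,d] :: 'a^4)$2 = b"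
  "(vector [a,b,c,d] :: 'a^4)$3 = c" "(vector [a,b,c,d] :: 'a^4)$4 = d"
  unfolding vector_def by simp_all

lemma two_view_matrix_mult:
  "two_view_matrix P Q x y *v vector [X$1, X$2, X$3, X$4, s, t] = 0 \<longleftrightarrow>
    P *v X + s *\<^sub>R x = 0 \<and> Q *v X + t *\<^sub>R y = 0"
  unfolding vec_eq_iff forall_6 forall_3 two_view_matrix_def
  by (simp add: matrix_vector_mult_def sum_6 sum_4 vector_6 mult.commute)

lemma two_view_det_eq_0_iff:
  "det (two_view_matrix P Q x y) = 0 \<longleftrightarrow>
    (\<exists>X s t. (X \<noteq> 0 \<or> s \<noteq> 0 \<or> t \<noteq> 0) \<and> P *v X + s *\<^sub>R x = 0 \<and> Q *v X + t *\<^sub>R y = 0)"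
proof -
  let ?V = "\<lambda>(X :: real^4) s t. vector [X$1, X$2, X$3, X$4, s, t] :: real^6"
  have nz: "?V X s t \<noteq> 0 \<longleftrightarrow> X \<noteq> 0 \<or> s \<noteq> 0 \<or> t \<noteq> 0" for X s t
    unfolding vec_eq_iff forall_6 forall_4 vector_6 by simp blast
  have rep: "z = ?V (vector [z$1, z$2, z$3, z$4]) (z$5) (z$6)" for z
    by (simp add: vec_eq_iff forall_6 vector_6 vector_4_nth)
  have "det (two_view_matrix P Q x y) = 0 \<longleftrightarrow> (\<exists>z. z \<noteq> 0 \<and> two_view_matrix P Q x y *v z = 0)"
    by (rule singular_iff_kernel)
  also have "\<dots> \<longleftrightarrow> (\<exists>X s t. ?V X s t \<noteq> 0 \<and> two_view_matrix P Q x y *v ?V X s t = 0)"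
  proof
    assume "\<exists>z. z \<noteq> 0 \<and> two_view_matrix P Q x y *v z = 0"
    then obtain z where "z \<noteq> 0 \<and> two_view_matrix P Q x y *v z = 0" ..
    then show "\<exists>X s t. ?V X s t \<noteq> 0 \<and> two_view_matrix P Q x y *v ?V X s t = 0"
      by (subst (asm) (1 2) rep) (intro exI)
  qed (elim exE, rule exI)
  finally show ?thesis
    unfolding nz two_view_matrix_mult .
qed

lemma psi_skew: "(P *v X) \<bullet> (psi P Q *v (Q *v X)) = 0"
proof -
  have "det (two_view_matrix P Q (P *v X) (Q *v X)) = 0"
    unfolding two_view_det_eq_0_iff
    \<comment> \<open>In the kernel vector \<open>(X, -1, -1)\<close> the last two columns cancel
      \<open>P X\<close> and \<open>Q X\<close>; it is nonzero even for
      \<open>X = 0\<close>.\<close>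
    by (rule exI[of _ X], rule exI[of _ "-1"], rule exI[of _ "-1"]) simp
  then show ?thesis by (simp add: psi)
qed

text \<open>\<open>(c, 0, 0)\<close> is a kernel vector for all \<open>x\<close> and
  \<open>y\<close>, so the bilinear form vanishes identically; \<open>x = psi P Q *v y\<close> then
  gives the claim.\<close>

lemma psi_common_center:
  assumes "P *v c = 0" "Q *v c = 0" "c \<noteq> 0"
  shows "psi P Q = 0"
proof -
  have "det (two_view_matrix P Q x y) = 0" for x y
    unfolding two_view_det_eq_0_iff
    by (rule exI[of _ c], rule exI[of _ 0], rule exI[of _ 0]) (simp add: assms)
  then have "(psi P Q *v y) \<bullet> (psi P Q *v y) = 0" for y
    unfolding psi .
  then have "psi P Q *v y = 0" for y
    by simp
  then show ?thesis
    by (simp add: matrix_eq)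
qed

text \<open>The aim is a pair \<open>x\<close>, \<open>y\<close> whose block matrix is injective.
  \<open>x\<close> is orthogonal to the image of the center of \<open>Q\<close>; \<open>y\<close> is
  orthogonal to the images under \<open>Q\<close> of the center \<open>c\<close> and of a preimage
  \<open>u\<close> of \<open>x\<close>. For a kernel vector this forces \<open>t\<close>, then
  \<open>s\<close>, then \<open>X\<close> to vanish.\<close>

lemma psi_nonzero:
  assumes "camera P" "camera Q" and distinct: "\<And>X. P *v X = 0 \<Longrightarrow> Q *v X = 0 \<Longrightarrow> X = 0"
  shows "psi P Q \<noteq> 0"
proof
  assume psi0: "psi P Q = 0"
  obtain c where c: "c \<noteq> 0" "P *v c = 0"
    using camera_kernel[OF assms(1)] by metis
  obtain d where d: "d \<noteq> 0" "Q *v d = 0"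
    using camera_kernel[OF assms(2)] by metis
  have ortho: "\<exists>z. z \<noteq> 0 \<and> z \<bullet> a = 0 \<and> z \<bullet> b = 0" for a b :: "real^3"
  proof -
    have "dim {a, b} < DIM(real^3)"
      using dim_le_card'[of "{a, b}"] card_insert_le_m1[of 2 "{b}" a] by simp
    then show ?thesis
    proof (rule orthogonal_to_subspace_exists)
      fix z assume z: "z \<noteq> 0" "\<And>v. v \<in> span {a, b} \<Longrightarrow> orthogonal z v"
      have "orthogonal z a" "orthogonal z b"
        by (rule z(2), simp add: span_base)+
      then show ?thesis
        using z(1) unfolding orthogonal_def by blast
    qed
  qed
  obtain x where x: "x \<noteq> 0" "x \<bullet> (P *v d) = 0"
    using ortho by blast
  obtain u where u: "P *v u = x"
    using camera_surj[OF assms(1)] by blast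
  obtain y where y: "y \<noteq> 0" "y \<bullet> (Q *v u) = 0" "y \<bullet> (Q *v c) = 0"
    using ortho by blast
  have "det (two_view_matrix P Q x y) = 0"
    by (simp add: psi psi0)
  then obtain X s t where nz: "X \<noteq> 0 \<or> s \<noteq> 0 \<or> t \<noteq> 0"
    and 1: "P *v X + s *\<^sub>R x = 0" and 2: "Q *v X + t *\<^sub>R y = 0"
    unfolding two_view_det_eq_0_iff by blast
  have "P *v (X + s *\<^sub>R u) = 0"
    using 1 by (simp add: matrix_vector_right_distrib matrix_vector_mult_scaleR u)
  then obtain a where "X + s *\<^sub>R u = a *\<^sub>R c"
    using camera_kernel_multiple[OF assms(1) c(2,1)] by metis
  then have X: "X = a *\<^sub>R c - s *\<^sub>R u" by (simp add: algebra_simps)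
  have "y \<bullet> (Q *v X) = 0"
    by (simp add: X matrix_vector_mult_diff_distrib matrix_vector_mult_scaleR inner_diff_right y)
  then have "t = 0"
    using arg_cong[OF 2, of "inner y"] y(1) by (simp add: inner_add_right)
  then have "Q *v X = 0" using 2 by simp
  then obtain b where b: "X = b *\<^sub>R d"
    using camera_kernel_multiple[OF assms(2) d(2,1)] by metis
  have "x \<bullet> (P *v X) = 0"
    by (simp add: b matrix_vector_mult_scaleR x)
  then have "s = 0"
    using arg_cong[OF 1, of "inner x"] x(1) by (simp add: inner_add_right)
  then have "X = 0"
    using distinct[of X] 1 2 \<open>t = 0\<close> by simp
  then show False using nz \<open>s = 0\<close> \<open>t = 0\<close> by simp
qed

text \<open>Forward, \<open>psi P Q ** Q\<close> is a skew form along \<open>P\<close> that vanishes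
  at the center of \<open>Q\<close>, hence a multiple of \<open>F ** Q\<close>, and the factor is
  nonzero because \<open>psi P Q\<close> is. Backward, rank 2 makes \<open>F\<close> and thus
  \<open>psi P Q\<close> nonzero, which excludes a common center.\<close>

lemma view_pair_iff_psi:
  assumes "camera P" "camera Q" "fundamental_matrix F"
  shows "view_pair F P Q \<longleftrightarrow> equal_up_to_scale F (psi P Q)"
proof
  assume vp: "view_pair F P Q"
  obtain d where d: "Q *v d = 0"
    and form: "\<And>M :: real^4^3. (\<And>X. (P *v X) \<bullet> (M *v X) = 0) \<Longrightarrow> M *v d = 0 \<Longrightarrow>
      \<exists>r. \<forall>X. M *v X = r *\<^sub>R (F *v (Q *v X))"
    using view_pair_form[OF assms vp] by metis
  have "\<exists>r. \<forall>X. (psi P Q ** Q) *v X = r *\<^sub>R (F *v (Q *v X))"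
    by (rule form) (simp_all add: psi_skew d flip: matrix_vector_mul_assoc)
  then obtain r where r: "psi P Q *v (Q *v X) = r *\<^sub>R (F *v (Q *v X))" for X
    by (auto simp: matrix_vector_mul_assoc)
  have "psi P Q *v y = (r *\<^sub>R F) *v y" for y
  proof -
    obtain X where "Q *v X = y" using camera_surj[OF assms(2)] by blast
    then show ?thesis using r[of X] by (simp add: scaleR_matrix_vector_assoc)
  qed
  then have "psi P Q = r *\<^sub>R F"
    by (simp add: matrix_eq)
  moreover have nz: "psi P Q \<noteq> 0"
    using psi_nonzero[OF assms(1,2)] view_pairD(2)[OF vp] by blast
  ultimately have "inverse r \<noteq> 0" "F = inverse r *\<^sub>R psi P Q"
    by auto
  then show "equal_up_to_scale F (psi P Q)"
    unfolding equal_up_to_scale_def by blast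
next
  assume "equal_up_to_scale F (psi P Q)"
  then obtain k where k: "k \<noteq> 0" "F = k *\<^sub>R psi P Q"
    by (auto simp: equal_up_to_scale_def)
  have "psi P Q \<noteq> 0"
    using assms(3) k by (auto simp: fundamental_matrix_def)
  then have "X = 0" if "P *v X = 0" "Q *v X = 0" for X
    using psi_common_center[OF that] by blast
  then show "view_pair F P Q"
    by (simp add: view_pair_def k psi_skew flip: scaleR_matrix_vector_assoc)
qed

section \<open>Three views with noncollinear centers\<close>

text \<open>For cameras this is linear independence of the centers, phrased with arbitrary kernel
  vectors so that neither spanning vectors nor coefficients have to be chosen.\<close>

definition noncollinear :: "real^4^3 \<Rightarrow> real^4^3 \<Rightarrow> real^4^3 \<Rightarrow> bool"
  where "noncollinear P Q R \<longleftrightarrow>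
    (\<forall>a b c. P *v a = 0 \<longrightarrow> Q *v b = 0 \<longrightarrow> R *v c = 0 \<longrightarrow> a + b + c = 0 \<longrightarrow> a = 0 \<and> b = 0 \<and> c = 0)"

lemma noncollinearD:
  assumes "noncollinear P Q R" "P *v a = 0" "Q *v b = 0" "R *v c = 0" "a + b + c = 0"
  shows "a = 0" "b = 0" "c = 0"
  using assms unfolding noncollinear_def by blast+

lemma noncollinear_swap12:
  assumes "noncollinear P Q R"
  shows "noncollinear Q P R"
  unfolding noncollinear_def
proof (intro allI impI)
  fix a b c assume 0: "Q *v a = 0" "P *v b = 0" "R *v c = 0" and "a + b + c = 0"
  then have "b + a + c = 0" by (simp only: add.commute[of b a])
  then show "a = 0 \<and> b = 0 \<and> c = 0"
    using noncollinearD[OF assms 0(2,1,3)] by blast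
qed

lemma noncollinear_swap23:
  assumes "noncollinear P Q R"
  shows "noncollinear P R Q"
  unfolding noncollinear_def
proof (intro allI impI)
  fix a b c assume 0: "P *v a = 0" "R *v b = 0" "Q *v c = 0" and "a + b + c = 0"
  then have "a + c + b = 0" by (simp only: ac_simps)
  then show "a = 0 \<and> b = 0 \<and> c = 0"
    using noncollinearD[OF assms 0(1,3,2)] by blast
qed

text \<open>\<open>Q3\<close> is a multiple of \<open>P3\<close> plus a term along the epipole from
  view 1, and also a multiple plus a term along the epipole from view 2. The difference of the two
  descriptions lies in the kernel of \<open>P3\<close>, and independence of the three centers
  removes the extra term.\<close>

lemma third_camera_unique:
  assumes cam: "camera P1" "camera P2" "camera P3" "camera Q3"
    and fund: "fundamental_matrix F13" "fundamental_matrix F23"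
    and P: "view_pair F13 P1 P3" "view_pair F23 P2 P3"
    and Q: "view_pair F13 P1 Q3" "view_pair F23 P2 Q3"
    and nc: "noncollinear P1 P2 P3"
  obtains s where "s \<noteq> 0" "Q3 = s *\<^sub>R P3"
proof -
  obtain a where a: "a \<noteq> 0" "P1 *v a = 0" using camera_kernel[OF cam(1)] by metis
  obtain b where b: "b \<noteq> 0" "P2 *v b = 0" using camera_kernel[OF cam(2)] by metis
  obtain c where c: "c \<noteq> 0" "P3 *v c = 0" using camera_kernel[OF cam(3)] by metis
  obtain r v where r: "r \<noteq> 0" and rv: "\<And>X. Q3 *v X = r *\<^sub>R (P3 *v X) + (v \<bullet> X) *\<^sub>R (P3 *v a)"
    using second_camera_freedom_camera[OF cam(1,3,4) fund(1) P(1) Q(1) a(2,1)] by metis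
  obtain s w where sw: "\<And>X. Q3 *v X = s *\<^sub>R (P3 *v X) + (w \<bullet> X) *\<^sub>R (P3 *v b)"
    using second_camera_freedom_camera[OF cam(2,3,4) fund(2) P(2) Q(2) b(2,1)] by metis
  have dep: "\<exists>k. (r - s) *\<^sub>R X + (v \<bullet> X) *\<^sub>R a - (w \<bullet> X) *\<^sub>R b = k *\<^sub>R c" for X
  proof -
    have "P3 *v ((r - s) *\<^sub>R X + (v \<bullet> X) *\<^sub>R a - (w \<bullet> X) *\<^sub>R b) = 0"
      using rv[of X] sw[of X]
      by (simp add: matrix_vector_right_distrib matrix_vector_mult_diff_distrib
          matrix_vector_mult_scaleR algebra_simps)
    then show ?thesis
      using camera_kernel_multiple[OF cam(3) c(2,1)] by metis
  qed
  \<comment> \<open>Otherwise division by \<open>r - s\<close> would put all of the four-dimensional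
    space into the span of three vectors.\<close>
  have "r = s"
  proof (rule ccontr)
    assume "r \<noteq> s"
    have "X \<in> span {a, b, c}" for X
    proof -
      obtain k where "(r - s) *\<^sub>R X + (v \<bullet> X) *\<^sub>R a - (w \<bullet> X) *\<^sub>R b = k *\<^sub>R c"
        using dep by blast
      then have "(r - s) *\<^sub>R X = k *\<^sub>R c + (w \<bullet> X) *\<^sub>R b - (v \<bullet> X) *\<^sub>R a"
        by (simp add: algebra_simps)
      also have "\<dots> \<in> span {a, b, c}"
        by (intro span_add span_diff span_mul span_base) auto
      finally have "(1 / (r - s)) *\<^sub>R (r - s) *\<^sub>R X \<in> span {a, b, c}"
        by (rule span_mul)
      then show ?thesis
        using \<open>r \<noteq> s\<close> by simp
    qed
    then have "span {a, b, c} = UNIV" by blast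
    then have "DIM(real^4) \<le> card {a, b, c}"
      using dim_le_card'[of "{a, b, c}"] dim_span[of "{a, b, c}"] by simp
    also have "card {a, b, c} \<le> 3"
      by (simp add: card_insert_if)
    finally show False by simp
  qed
  have "v \<bullet> X = 0" for X
  proof -
    obtain k where "(v \<bullet> X) *\<^sub>R a - (w \<bullet> X) *\<^sub>R b = k *\<^sub>R c"
      using dep[of X] \<open>r = s\<close> by auto
    then have "(v \<bullet> X) *\<^sub>R a + - (w \<bullet> X) *\<^sub>R b + - k *\<^sub>R c = 0"
      by simp
    moreover have "P1 *v ((v \<bullet> X) *\<^sub>R a) = 0" "P2 *v (- (w \<bullet> X) *\<^sub>R b) = 0" "P3 *v (- k *\<^sub>R c) = 0"
      by (simp_all only: matrix_vector_mult_scaleR a b c scaleR_zero_right)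
    ultimately have "(v \<bullet> X) *\<^sub>R a = 0"
      using noncollinearD(1)[OF nc] by blast
    then show ?thesis using a by simp
  qed
  then have "Q3 = r *\<^sub>R P3"
    by (simp add: matrix_eq rv scaleR_matrix_vector_assoc)
  then show thesis using r that by blast
qed

text \<open>The first two views are aligned by a projective transformation; the third camera then
  has only its scale left.\<close>

lemma three_view_uniqueness:
  assumes cam: "camera P1" "camera P2" "camera P3" "camera Q1" "camera Q2" "camera Q3"
    and fund: "fundamental_matrix F12" "fundamental_matrix F13" "fundamental_matrix F23"
    and P: "view_pair F12 P1 P2" "view_pair F13 P1 P3" "view_pair F23 P2 P3"
    and Q: "view_pair F12 Q1 Q2" "view_pair F13 Q1 Q3" "view_pair F23 Q2 Q3"
    and nc: "noncollinear P1 P2 P3"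
  obtains H r s where "invertible H" "r \<noteq> 0" "s \<noteq> 0"
    "Q1 ** H = r *\<^sub>R P1" "Q2 ** H = P2" "Q3 ** H = s *\<^sub>R P3"
proof -
  obtain H r where H: "invertible H" and r: "r \<noteq> 0" and QH: "Q1 ** H = r *\<^sub>R P1" "Q2 ** H = P2"
    using two_view_uniqueness[OF cam(1,2,4,5) fund(1) P(1) Q(1)] by metis
  have "view_pair F13 P1 (Q3 ** H)"
    using view_pair_compose[OF Q(2) H] view_pair_scale[of r 1 F13 P1 "Q3 ** H"] r QH by simp
  moreover have "view_pair F23 P2 (Q3 ** H)"
    using view_pair_compose[OF Q(3) H] QH by simp
  ultimately obtain s where "s \<noteq> 0" "Q3 ** H = s *\<^sub>R P3"
    using third_camera_unique[OF cam(1-3) camera_compose[OF cam(6) H] fund(2,3) P(2,3) _ _ nc] by metis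
  then show thesis using that H r QH by blast
qed

text \<open>The sides of a triangle through the vertex \<open>A\<close> meet only there, so a center
  on both sides would be the center of \<open>A\<close>.\<close>

lemma noncollinear_fourth:
  assumes "camera L" and nc: "noncollinear A B C"
    and distinct: "\<And>X. A *v X = 0 \<Longrightarrow> L *v X = 0 \<Longrightarrow> X = 0"
  shows "noncollinear A B L \<or> noncollinear A C L"
proof (rule ccontr)
  assume "\<not> ?thesis"
  then obtain a b l a' c l'
    where 1: "A *v a = 0" "B *v b = 0" "L *v l = 0" "a + b + l = 0" "a \<noteq> 0 \<or> b \<noteq> 0 \<or> l \<noteq> 0"
      and 2: "A *v a' = 0" "C *v c = 0" "L *v l' = 0" "a' + c + l' = 0" "a' \<noteq> 0 \<or> c \<noteq> 0 \<or> l' \<noteq> 0"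
    unfolding noncollinear_def by blast
  note nc' = noncollinearD[OF nc]
  have "l' \<noteq> 0"
    using nc'[of a' 0 c] 2 by auto
  have "l \<noteq> 0"
    using nc'[of a b 0] 1 by auto
  obtain k where k: "l = k *\<^sub>R l'"
    using camera_kernel_multiple[OF assms(1) 2(3) \<open>l' \<noteq> 0\<close> 1(3)] by metis
  have Ck: "C *v ((- k) *\<^sub>R c) = 0"
    by (simp only: matrix_vector_mult_scaleR 2 scaleR_zero_right)
  \<comment> \<open>Subtracting the two relations, scaled to the same multiple of the center of
    \<open>L\<close>, leaves a relation among the vertices of the triangle.\<close>
  have "(a - k *\<^sub>R a') + b + (- k) *\<^sub>R c = (a + b + l) - k *\<^sub>R (a' + c + l')"
    by (simp add: k algebra_simps)
  then have "b = 0"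
    using nc'(2)[OF _ 1(2) Ck, of "a - k *\<^sub>R a'"] 1 2
    by (simp add: matrix_vector_mult_diff_distrib matrix_vector_mult_scaleR)
  then have "a = - l" using 1 by (simp add: eq_neg_iff_add_eq_0)
  then have "A *v l = 0"
    using 1(1) matrix_vector_mult_scaleR[of A "-1" l] by simp
  then show False using distinct 1 \<open>l \<noteq> 0\<close> by blast
qed

section \<open>Gluing reconstructions\<close>

text \<open>Both orders of each pair are required, so that indices can be permuted freely and the
  notion restricts to subsets.\<close>

definition reconstruction ::
    "nat set \<Rightarrow> (nat \<Rightarrow> nat \<Rightarrow> real^3^3) \<Rightarrow> (nat \<Rightarrow> real^4^3) \<Rightarrow> bool"
  where "reconstruction I F P \<longleftrightarrow>
    (\<forall>i\<in>I. camera (P i)) \<and> (\<forall>i\<in>I. \<forall>j\<in>I. i \<noteq> j \<longrightarrow> view_pair (F i j) (P i) (P j))"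

lemma reconstructionD:
  assumes "reconstruction I F P"
  shows "i \<in> I \<Longrightarrow> camera (P i)"
    and "i \<in> I \<Longrightarrow> j \<in> I \<Longrightarrow> i \<noteq> j \<Longrightarrow> view_pair (F i j) (P i) (P j)"
  using assms by (auto simp: reconstruction_def)

lemma reconstruction_subset: "reconstruction I F P \<Longrightarrow> J \<subseteq> I \<Longrightarrow> reconstruction J F P"
  unfolding reconstruction_def by blast

lemma reconstruction_cong:
  assumes "\<And>i. i \<in> I \<Longrightarrow> P i = Q i"
  shows "reconstruction I F P \<longleftrightarrow> reconstruction I F Q"
  using assms unfolding reconstruction_def by simp

lemma camera_scale:
  assumes "camera P" "s \<noteq> 0"
  shows "camera (s *\<^sub>R P)"
proof -
  have "\<exists>X. (s *\<^sub>R P) *v X = y" for y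
  proof -
    obtain X where "P *v X = inverse s *\<^sub>R y"
      using camera_surj[OF assms(1)] by blast
    then have "(s *\<^sub>R P) *v X = y"
      using assms(2) by (simp flip: scaleR_matrix_vector_assoc)
    then show ?thesis ..
  qed
  then show ?thesis by (rule cameraI)
qed

lemma reconstruction_transform:
  assumes "reconstruction I F P" "invertible H" "\<And>i. s i \<noteq> (0 :: real)"
  shows "reconstruction I F (\<lambda>i. s i *\<^sub>R (P i ** H))"
  using assms by (simp add: reconstruction_def camera_scale camera_compose view_pair_scale view_pair_compose)

lemma same_epipole:
  assumes "fundamental_matrix A" "fundamental_matrix B" "A *v v = 0" "B *v v = 0" "v \<noteq> 0"
  shows "{x. A *v x = 0} = {x. B *v x = 0}"
proof -
  have "\<exists>a. x = a *\<^sub>R v" if "A *v x = 0 \<or> B *v x = 0" for x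
    using fundamental_kernel_multiple[OF assms(1,3,5)] fundamental_kernel_multiple[OF assms(2,4,5)] that
    by metis
  then show ?thesis
    using assms(3,4) by (auto simp: matrix_vector_mult_scaleR) (metis matrix_vector_mult_scaleR scaleR_zero_right)+
qed

section \<open>Families of fundamental matrices closed under transposition\<close>

locale fundamental_family =
  fixes I :: "nat set" and F :: "nat \<Rightarrow> nat \<Rightarrow> real^3^3"
  assumes fundamental: "i \<in> I \<Longrightarrow> j \<in> I \<Longrightarrow> i \<noteq> j \<Longrightarrow> fundamental_matrix (F i j)"
    and transpose_F: "i \<in> I \<Longrightarrow> j \<in> I \<Longrightarrow> i \<noteq> j \<Longrightarrow> transpose (F i j) = F j i"
begin

text \<open>\<open>E\<close> may list a pair in one order only; transposition supplies the other. On
  listed pairs the epipolar constraint replaces \<open>psi\<close>.\<close>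

lemma solution_iff_reconstruction:
  assumes "Field E = J" "J \<subseteq> I" "\<And>i j. (i, j) \<in> E \<Longrightarrow> i \<noteq> j"
    and tot: "\<And>i j. i \<in> J \<Longrightarrow> j \<in> J \<Longrightarrow> i \<noteq> j \<Longrightarrow> (i, j) \<in> E \<or> (j, i) \<in> E"
  shows "solution E F P \<longleftrightarrow> reconstruction J F P"
proof -
  have E: "i \<in> J \<and> j \<in> J \<and> i \<noteq> j" if "(i, j) \<in> E" for i j
    using that assms(1,3) by (auto intro: FieldI1 FieldI2)
  have "solution E F P \<longleftrightarrow> (\<forall>i\<in>J. camera (P i)) \<and> (\<forall>(i, j)\<in>E. view_pair (F i j) (P i) (P j))"
    unfolding solution_def assms(1)
  proof (rule conj_cong[OF refl])
    assume cam: "\<forall>i\<in>J. camera (P i)"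
    have "equal_up_to_scale (F i j) (psi (P i) (P j)) \<longleftrightarrow> view_pair (F i j) (P i) (P j)"
      if "(i, j) \<in> E" for i j
      using E[OF that] cam fundamental assms(2) view_pair_iff_psi[of "P i" "P j" "F i j"] by auto
    then show "(\<forall>(i, j)\<in>E. equal_up_to_scale (F i j) (psi (P i) (P j))) \<longleftrightarrow>
        (\<forall>(i, j)\<in>E. view_pair (F i j) (P i) (P j))"
      by auto
  qed
  also have "\<dots> \<longleftrightarrow> reconstruction J F P"
    unfolding reconstruction_def
  proof (rule conj_cong[OF refl], intro iffI ballI impI)
    fix i j assume *: "\<forall>(i, j)\<in>E. view_pair (F i j) (P i) (P j)" "i \<in> J" "j \<in> J" "i \<noteq> j"
    show "view_pair (F i j) (P i) (P j)"
    proof (cases "(i, j) \<in> E")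
      case False
      then have "view_pair (F j i) (P j) (P i)"
        using tot * by blast
      then have "view_pair (transpose (F j i)) (P i) (P j)"
        by (rule view_pair_transpose)
      moreover have "transpose (F j i) = F i j"
        using transpose_F * assms(2) by blast
      ultimately show ?thesis by simp
    qed (use * in blast)
  qed (use E in blast)
  finally show ?thesis .
qed

text \<open>Uniqueness of three views yields \<open>H\<close> that takes the cameras
  \<open>i\<close>, \<open>j\<close>, \<open>k\<close> of \<open>Q\<close> to multiples of those of
  \<open>R\<close>. View pairs ignore scale, so each camera may be rescaled separately.\<close>

lemma normalise_reconstruction:
  assumes Q: "reconstruction J F Q" and R: "reconstruction {i, j, k} F R"
    and ijk: "i \<noteq> j" "i \<noteq> k" "j \<noteq> k" "{i, j, k} \<subseteq> J" "J \<subseteq> I"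
    and nc: "noncollinear (R i) (R j) (R k)"
  obtains Q' where "reconstruction J F Q'" "Q' i = R i" "Q' j = R j" "Q' k = R k"
proof -
  have R': "camera (R i)" "camera (R j)" "camera (R k)" "view_pair (F i j) (R i) (R j)"
    "view_pair (F i k) (R i) (R k)" "view_pair (F j k) (R j) (R k)"
    using R ijk by (auto simp: reconstruction_def)
  have Q': "camera (Q i)" "camera (Q j)" "camera (Q k)" "view_pair (F i j) (Q i) (Q j)"
    "view_pair (F i k) (Q i) (Q k)" "view_pair (F j k) (Q j) (Q k)"
    using Q ijk by (auto simp: reconstruction_def)
  have F': "fundamental_matrix (F i j)" "fundamental_matrix (F i k)" "fundamental_matrix (F j k)"
    using ijk fundamental by auto
  obtain H r s where H: "invertible H" "r \<noteq> 0" "s \<noteq> 0"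
    "Q i ** H = r *\<^sub>R R i" "Q j ** H = R j" "Q k ** H = s *\<^sub>R R k"
    using three_view_uniqueness[OF R'(1-3) Q'(1-3) F' R'(4-6) Q'(4-6) nc] by metis
  let ?s = "\<lambda>l. if l = i then inverse r else if l = k then inverse s else 1"
  show thesis
  proof (rule that)
    show "reconstruction J F (\<lambda>l. ?s l *\<^sub>R (Q l ** H))"
      by (rule reconstruction_transform[OF Q H(1)]) (use H in auto)
  qed (use H ijk in auto)
qed

text \<open>A linear relation among the centers loses its term \<open>a\<close> under
  \<open>R i\<close>. The centers of \<open>j\<close> and \<open>k\<close> then have the same image
  in view \<open>i\<close>, and this image spans both epipoles.\<close>

lemma noncollinear_of_epipoles:
  assumes R: "reconstruction {i, j, k} F R" and ijk: "i \<noteq> j" "i \<noteq> k" "j \<noteq> k" "{i, j, k} \<subseteq> I"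
    and ne: "epipole F j i \<noteq> epipole F k i"
  shows "noncollinear (R i) (R j) (R k)"
proof (rule ccontr)
  assume "\<not> ?thesis"
  then obtain a b c where abc: "R i *v a = 0" "R j *v b = 0" "R k *v c = 0" "a + b + c = 0"
    "a \<noteq> 0 \<or> b \<noteq> 0 \<or> c \<noteq> 0"
    unfolding noncollinear_def by blast
  have v: "view_pair (F j i) (R j) (R i)" "view_pair (F k i) (R k) (R i)"
    and cam: "camera (R j)" "camera (R k)"
    using R ijk by (auto simp: reconstruction_def)
  have neg: "R l *v (- x) = - (R l *v x)" for l x
    using matrix_vector_mult_scaleR[of "R l" "-1" x] by simp
  have "c = - a - b" using abc(4) by (simp add: algebra_simps eq_neg_iff_add_eq_0)
  then have Pc: "R i *v c = - (R i *v b)"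
    by (simp add: matrix_vector_mult_diff_distrib neg abc)
  have "R i *v b \<noteq> 0"
  proof
    assume 0: "R i *v b = 0"
    then have "b = 0" using view_pairD(2)[OF v(1)] abc by blast
    have "c = 0" using view_pairD(2)[OF v(2), of c] abc Pc 0 by simp
    then show False using \<open>b = 0\<close> abc by simp
  qed
  moreover have "F j i *v (R i *v b) = 0"
    using epipole_of_center[OF v(1) cam(1)] abc by blast
  moreover have "F k i *v (R i *v b) = 0"
    using epipole_of_center[OF v(2) cam(2) abc(3)] matrix_vector_mult_scaleR[of "F k i" "-1" "R i *v b"]
    by (simp add: Pc)
  moreover have "fundamental_matrix (F j i)" "fundamental_matrix (F k i)"
    using ijk fundamental by auto
  ultimately show False
    using ne same_epipole unfolding epipole_def by blast
qed

lemma glue_noncollinear: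
  assumes quads: "\<And>i j k l. distinct [i, j, k, l] \<Longrightarrow> {i, j, k, l} \<subseteq> I \<Longrightarrow> \<exists>P. reconstruction {i, j, k, l} F P"
    and R: "reconstruction {i, j, k} F R" and ijk: "i \<noteq> j" "i \<noteq> k" "j \<noteq> k" "{i, j, k} \<subseteq> I"
    and nc: "noncollinear (R i) (R j) (R k)"
  shows "\<exists>P. reconstruction I F P"
proof -
  \<comment> \<open>Every quadruple through the triangle is normalised to extend \<open>R\<close>
    exactly; for \<open>l\<close> in the triangle it degenerates and \<open>R\<close> itself
    serves.\<close>
  have "\<exists>Q. reconstruction {i, j, k, l} F Q \<and> Q i = R i \<and> Q j = R j \<and> Q k = R k" if "l \<in> I" for l
  proof -
    have "\<exists>Q. reconstruction {i, j, k, l} F Q"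
    proof (cases "l \<in> {i, j, k}")
      case True
      then have "{i, j, k, l} = {i, j, k}" by auto
      then show ?thesis using R by auto
    qed (use quads[of i j k l] ijk that in auto)
    then obtain Q where Q: "reconstruction {i, j, k, l} F Q" ..
    have "{i, j, k} \<subseteq> {i, j, k, l}" "{i, j, k, l} \<subseteq> I"
      using ijk(4) that by auto
    from normalise_reconstruction[OF Q R ijk(1-3) this nc] show ?thesis by metis
  qed
  then obtain Q where Q: "\<And>l. l \<in> I \<Longrightarrow> reconstruction {i, j, k, l} F (Q l)"
    "\<And>l. l \<in> I \<Longrightarrow> Q l i = R i" "\<And>l. l \<in> I \<Longrightarrow> Q l j = R j" "\<And>l. l \<in> I \<Longrightarrow> Q l k = R k"
    by metis
  \<comment> \<open>Camera \<open>l\<close> comes from its own quadruple. As all quadruples agree on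
    the triangle, \<open>P\<close> and \<open>Q l\<close> agree on
    \<open>{i, j, k, l}\<close>.\<close>
  define P where "P l = Q l l" for l
  have P: "P i = R i" "P j = R j" "P k = R k"
    using Q ijk by (auto simp: P_def)
  have recP: "reconstruction {i, j, k, l} F P" if "l \<in> I" for l
  proof -
    have "P x = Q l x" if "x \<in> {i, j, k, l}" for x
      using that P Q(2-4)[OF \<open>l \<in> I\<close>] by (auto simp: P_def)
    then show ?thesis
      using Q(1)[OF that] reconstruction_cong[of "{i, j, k, l}" P "Q l" F] by blast
  qed
  have ncP: "noncollinear (P i) (P j) (P k)"
    using nc P by simp
  \<comment> \<open>Each center outside \<open>{i, j, k}\<close> lies on at most one of the three sides of the triangle
    \<open>i, j, k\<close>, so some side avoids the two centers \<open>l\<close> and \<open>m\<close>.\<close>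
  have good: "\<exists>a b. a \<in> {i, j, k} \<and> b \<in> {i, j, k} \<and> a \<noteq> b \<and>
      noncollinear (P a) (P b) (P l) \<and> noncollinear (P a) (P b) (P m)"
    if lm: "l \<in> I" "m \<in> I" "l \<notin> {i, j, k}" "m \<notin> {i, j, k}" for l m
  proof -
    have two: "(noncollinear (P i) (P j) (P x) \<or> noncollinear (P i) (P k) (P x)) \<and>
        (noncollinear (P i) (P j) (P x) \<or> noncollinear (P j) (P k) (P x)) \<and>
        (noncollinear (P i) (P k) (P x) \<or> noncollinear (P j) (P k) (P x))"
      if x: "x \<in> I" "x \<notin> {i, j, k}" for x
    proof -
      have cam: "camera (P x)"
        using recP[OF x(1)] by (simp add: reconstruction_def)
      have d: "X = 0" if "P y *v X = 0" "P x *v X = 0" "y \<in> {i, j, k}" for X y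
        using view_pairD(2)[OF reconstructionD(2)[OF recP[OF x(1)], of y x]] x that by auto
      note nc2 = noncollinear_swap12[OF ncP]
      note nc3 = noncollinear_swap12[OF noncollinear_swap23[OF ncP]]
      have "noncollinear (P i) (P j) (P x) \<or> noncollinear (P i) (P k) (P x)"
        by (rule noncollinear_fourth[OF cam ncP]) (use d in blast)
      moreover have "noncollinear (P j) (P i) (P x) \<or> noncollinear (P j) (P k) (P x)"
        by (rule noncollinear_fourth[OF cam nc2]) (use d in blast)
      moreover have "noncollinear (P k) (P i) (P x) \<or> noncollinear (P k) (P j) (P x)"
        by (rule noncollinear_fourth[OF cam nc3]) (use d in blast)
      ultimately show ?thesis
        using noncollinear_swap12 by blast
    qed
    show ?thesis
      using two[OF lm(1,3)] two[OF lm(2,4)] ijk by blast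
  qed
  have "view_pair (F l m) (P l) (P m)" if lm: "l \<in> I" "m \<in> I" "l \<noteq> m" for l m
  proof (cases "l \<in> {i, j, k} \<or> m \<in> {i, j, k}")
    case True
    then show ?thesis
      using reconstructionD(2)[OF recP[OF lm(1)], of l m] reconstructionD(2)[OF recP[OF lm(2)], of l m] lm(3)
      by auto
  next
    case False
    then obtain a b where ab: "a \<in> {i, j, k}" "b \<in> {i, j, k}" "a \<noteq> b"
      and nl: "noncollinear (P a) (P b) (P l)" and nm: "noncollinear (P a) (P b) (P m)"
      using good[of l m] lm by blast
    have abI: "a \<in> I" "b \<in> I" using ab ijk by auto
    have ne: "a \<noteq> l" "b \<noteq> l" "a \<noteq> m" "b \<noteq> m" using ab False by auto
    have "{a, b, l} \<subseteq> {i, j, k, l}" "{a, b, m} \<subseteq> {i, j, k, m}"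
      using ab by auto
    note abl = reconstruction_subset[OF recP[OF lm(1)] this(1)]
      and abm = reconstruction_subset[OF recP[OF lm(2)] this(2)]
    \<comment> \<open>This quadruple can be aligned with \<open>P\<close> at \<open>a\<close>,
      \<open>b\<close>, \<open>l\<close>. Its camera \<open>m\<close> and \<open>P m\<close> are
      then both third cameras over \<open>a\<close>, \<open>b\<close>, hence proportional.\<close>
    obtain S0 where S0: "reconstruction {a, b, l, m} F S0"
      using quads[of a b l m] ab abI ne lm by auto
    have "{a, b, l} \<subseteq> {a, b, l, m}" "{a, b, l, m} \<subseteq> I"
      using abI lm by auto
    from normalise_reconstruction[OF S0 abl ab(3) ne(1,2) this nl]
    obtain S where S: "reconstruction {a, b, l, m} F S" "S a = P a" "S b = P b" "S l = P l"
      by metis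
    obtain s where s: "s \<noteq> 0" "S m = s *\<^sub>R P m"
    proof (rule third_camera_unique[OF _ _ _ _ _ _ _ _ _ _ nm, of "S m" "F a m" "F b m"])
      show "camera (P a)" "camera (P b)" "camera (P m)"
        "view_pair (F a m) (P a) (P m)" "view_pair (F b m) (P b) (P m)"
        using abm ne by (auto simp: reconstruction_def)
      show "camera (S m)" "view_pair (F a m) (P a) (S m)" "view_pair (F b m) (P b) (S m)"
        using S ne by (auto simp: reconstruction_def)
      show "fundamental_matrix (F a m)" "fundamental_matrix (F b m)"
        using fundamental abI lm ne by auto
    qed
    have "view_pair (F l m) (S l) (S m)"
      using reconstructionD(2)[OF S(1), of l m] lm by simp
    then show ?thesis
      using view_pair_scale[of 1 s "F l m" "P l" "P m"] s S by simp
  qed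
  then have "reconstruction I F P"
    using recP unfolding reconstruction_def by blast
  then show ?thesis by blast
qed

text \<open>View \<open>i\<close> projects every other center to the one epipole, which is the image
  of the center \<open>b\<close> of \<open>j\<close>. Such a center is a multiple of
  \<open>b\<close> up to the kernel of \<open>P i\<close>, so it lies on the line joining the
  centers of \<open>i\<close> and \<open>j\<close>.\<close>

lemma collinear_centers:
  assumes P: "reconstruction I F P" and I: "i \<in> I" "j \<in> I" "i \<noteq> j"
    and coincide: "\<And>i j k. i \<in> I \<Longrightarrow> j \<in> I \<Longrightarrow> k \<in> I \<Longrightarrow> j \<noteq> i \<Longrightarrow> k \<noteq> i \<Longrightarrow> epipole F j i = epipole F k i"
  shows "\<exists>L. projective_line L \<and> (\<forall>i\<in>I. center (P i) \<subseteq> L)"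
proof -
  obtain a where a: "a \<noteq> 0" "P i *v a = 0"
    using camera_kernel[OF reconstructionD(1)[OF P I(1)]] by metis
  obtain b where b: "b \<noteq> 0" "P j *v b = 0"
    using camera_kernel[OF reconstructionD(1)[OF P I(2)]] by metis
  have Pib: "P i *v b \<noteq> 0"
    using view_pairD(2)[OF reconstructionD(2)[OF P I]] b by blast
  have "a \<notin> span {b}"
    using Pib a by (auto simp: span_singleton matrix_vector_mult_scaleR)
  then have "independent {a, b}" "a \<noteq> b"
    using b by (auto simp: independent_insert span_base)
  then have "dim (span {a, b}) = 2"
    by (simp add: dim_eq_card_independent)
  then have "projective_line (span {a, b})"
    by (simp add: projective_line_def)
  moreover have "v \<in> span {a, b}" if k: "k \<in> I" "P k *v v = 0" for k v
  proof (cases "k = i")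
    case True
    then obtain x where "v = x *\<^sub>R a"
      using camera_kernel_multiple[OF reconstructionD(1)[OF P I(1)] a(2,1)] k by metis
    then show ?thesis by (simp add: span_mul span_base)
  next
    case False
    have "F k i *v (P i *v v) = 0"
      using epipole_of_center[OF reconstructionD(2)[OF P k(1) I(1) False] reconstructionD(1)[OF P k(1)] k(2)] .
    then have "F j i *v (P i *v v) = 0"
      using coincide[OF I(1,2) k(1)] I False unfolding epipole_def by auto
    moreover have "F j i *v (P i *v b) = 0"
      using epipole_of_center[OF reconstructionD(2)[OF P I(2,1)] reconstructionD(1)[OF P I(2)] b(2)] I by simp
    ultimately obtain x where x: "P i *v v = x *\<^sub>R (P i *v b)"
      using fundamental_kernel_multiple[OF fundamental[OF I(2,1)]] Pib I by metis
    then have "P i *v (v - x *\<^sub>R b) = 0"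
      by (simp add: matrix_vector_mult_diff_distrib matrix_vector_mult_scaleR)
    then obtain y where "v - x *\<^sub>R b = y *\<^sub>R a"
      using camera_kernel_multiple[OF reconstructionD(1)[OF P I(1)] a(2,1)] by metis
    then have "v = y *\<^sub>R a + x *\<^sub>R b" by (simp add: algebra_simps)
    then show ?thesis by (simp add: span_add span_mul span_base)
  qed
  ultimately show ?thesis
    unfolding center_def by blast
qed

end

section \<open>Coincident epipoles\<close>

text \<open>Terms along the epipoles are invisible to the constraint: \<open>G\<close> kills
  \<open>q\<close>, and \<open>transpose G\<close> kills \<open>p\<close>.\<close>

lemma second_camera_form:
  fixes M N :: "real^4^3" and G :: "real^3^3"
  assumes "view_pair G P Q" "\<And>X. M *v X = r *\<^sub>R (P *v X) + (v \<bullet> X) *\<^sub>R p"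
    "\<And>X. N *v X = s *\<^sub>R (Q *v X) + (w \<bullet> X) *\<^sub>R q"
    "transpose G *v p = 0" "G *v q = 0"
  shows "(M *v X) \<bullet> (G *v (N *v X)) = 0"
proof -
  have "G *v (N *v X) = s *\<^sub>R (G *v (Q *v X))"
    by (simp add: assms matrix_vector_right_distrib matrix_vector_mult_scaleR)
  moreover have "p \<bullet> (G *v (Q *v X)) = 0"
    by (simp only: dot_transpose[of p] assms inner_zero_left)
  ultimately show ?thesis
    using view_pairD(1)[OF assms(1)] by (simp add: assms(2) inner_add_left)
qed

text \<open>\<open>b\<close> is a reference view and \<open>e i\<close> represents the common
  epipole in image \<open>i\<close>. Unit length lets coordinates along \<open>e i\<close> be read
  off as inner products.\<close>

locale coincident_epipoles = fundamental_family +
  fixes b :: nat and e :: "nat \<Rightarrow> real^3"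
  assumes base: "b \<in> I"
    and unit: "i \<in> I \<Longrightarrow> e i \<bullet> e i = 1"
    and F_e: "i \<in> I \<Longrightarrow> j \<in> I \<Longrightarrow> i \<noteq> j \<Longrightarrow> F j i *v e i = 0"
    and triples: "distinct [i, j, k] \<Longrightarrow> {i, j, k} \<subseteq> I \<Longrightarrow> \<exists>P. reconstruction {i, j, k} F P"
begin

lemma e_nonzero: "i \<in> I \<Longrightarrow> e i \<noteq> 0"
  using unit by fastforce

lemma transpose_F_e: "i \<in> I \<Longrightarrow> j \<in> I \<Longrightarrow> i \<noteq> j \<Longrightarrow> transpose (F i j) *v e i = 0"
  using F_e transpose_F by metis

lemma inner_F_e: "i \<in> I \<Longrightarrow> j \<in> I \<Longrightarrow> i \<noteq> j \<Longrightarrow> e i \<bullet> (F i j *v y) = 0"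
  by (metis dot_transpose transpose_F_e inner_zero_left)

text \<open>For \<open>k\<close> equal to \<open>i\<close> or \<open>j\<close>, the map
  \<open>x\<close> to \<open>e k \<times> (F k b *v x)\<close>, composed with the camera of
  \<open>b\<close>, satisfies the constraint of the pair \<open>b\<close>, \<open>k\<close>, since
  \<open>y\<close> is orthogonal to \<open>e k \<times> y\<close>. It is therefore a multiple of the
  camera of \<open>k\<close> plus a term along \<open>e k\<close>, and the constraint between
  \<open>i\<close> and \<open>j\<close> carries over.\<close>

lemma triple_form:
  assumes ij: "i \<in> I" "j \<in> I" "i \<noteq> j" "i \<noteq> b" "j \<noteq> b"
  shows "(e i \<times> (F i b *v x)) \<bullet> (F i j *v (e j \<times> (F j b *v x))) = 0"
proof -
  obtain Q where Q: "reconstruction {b, i, j} F Q"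
    using triples[of b i j] ij base by auto
  have cam: "camera (Q b)"
    using Q by (simp add: reconstruction_def)
  obtain c where c: "c \<noteq> 0" "Q b *v c = 0"
    using camera_kernel[OF cam] by metis
  obtain X where X: "Q b *v X = x"
    using camera_surj[OF cam] by blast
  have lin: "linear (\<lambda>X. e k \<times> (F k b *v (Q b *v X)))" for k
    by (rule linearI)
      (simp_all add: matrix_vector_right_distrib matrix_vector_mult_scaleR cross_add_right cross_mult_right)
  define M where "M k = matrix (\<lambda>X. e k \<times> (F k b *v (Q b *v X)))" for k
  have M: "M k *v X = e k \<times> (F k b *v (Q b *v X))" for k X
    by (simp add: M_def matrix_works linear_matrix_vector_mul_eq lin)
  have dev: "\<exists>r w p. (\<forall>X. M k *v X = r *\<^sub>R (Q k *v X) + (w \<bullet> X) *\<^sub>R p) \<and> (\<exists>t. p = t *\<^sub>R e k)"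
    if k: "k \<in> {i, j}" for k
  proof -
    have kI: "k \<in> I" "k \<noteq> b" using k ij by auto
    have vp: "view_pair (F b k) (Q b) (Q k)" and camk: "camera (Q k)"
      using Q k ij by (auto simp: reconstruction_def)
    have fund: "fundamental_matrix (F b k)"
      using fundamental base kI by simp
    have "(Q b *v X) \<bullet> (F b k *v (M k *v X)) = 0" for X
    proof -
      have "transpose (F b k) = F k b"
        using transpose_F base kI by simp
      then show ?thesis
        by (simp add: M dot_transpose[of "Q b *v X"] dot_cross_self)
    qed
    then obtain r w where "\<And>X. M k *v X = r *\<^sub>R (Q k *v X) + (w \<bullet> X) *\<^sub>R (Q k *v c)"
      using second_camera_freedom[OF cam camk fund vp _ c(2,1), of "M k"] by metis
    moreover obtain t where "Q k *v c = t *\<^sub>R e k"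
      using fundamental_kernel_multiple[OF fund F_e[OF kI(1) base kI(2)] e_nonzero[OF kI(1)]
          epipole_of_center[OF vp cam c(2)]] by metis
    ultimately show ?thesis by metis
  qed
  obtain r v p t where i: "\<And>X. M i *v X = r *\<^sub>R (Q i *v X) + (v \<bullet> X) *\<^sub>R p" "p = t *\<^sub>R e i"
    using dev[of i] by auto
  obtain s w q u where j: "\<And>X. M j *v X = s *\<^sub>R (Q j *v X) + (w \<bullet> X) *\<^sub>R q" "q = u *\<^sub>R e j"
    using dev[of j] by auto
  have "(M i *v X) \<bullet> (F i j *v (M j *v X)) = 0"
  proof (rule second_camera_form[OF _ i(1) j(1)])
    show "view_pair (F i j) (Q i) (Q j)"
      using Q ij by (simp add: reconstruction_def)
    show "transpose (F i j) *v p = 0"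
      by (simp only: i(2) matrix_vector_mult_scaleR transpose_F_e[OF ij(1-3)] scaleR_zero_right)
    show "F i j *v q = 0"
      by (simp add: j(2) matrix_vector_mult_scaleR F_e ij(1,2) ij(3)[symmetric])
  qed
  then show ?thesis by (simp add: M X)
qed

text \<open>The cameras will be \<open>[img i | i * e i]\<close>, with distinct centers \<open>(i * e b, -1)\<close>. Up to scale and
  up to adding a matrix with range spanned by \<open>e i\<close>, \<open>img i\<close> is the only solution of \<open>F b i ** img i\<close>
  being skew-symmetric.\<close>

definition img :: "nat \<Rightarrow> real^3 \<Rightarrow> real^3"
  where "img i x = (if i = b then x else e i \<times> (F i b *v x) + (e b \<bullet> x) *\<^sub>R e i)"

lemma linear_img: "linear (img i)"
  unfolding img_def
  by (rule linearI)
    (simp_all add: matrix_vector_right_distrib matrix_vector_mult_scaleR cross_add_right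
      cross_mult_right inner_add_right algebra_simps)

text \<open>This allows the fourth column \<open>i * e i\<close> to be absorbed into the argument of
  \<open>img i\<close>.\<close>

lemma img_base_epipole: "i \<in> I \<Longrightarrow> img i (e b) = e i"
  using F_e[of b i] unit[of b] base by (simp add: img_def)

text \<open>The two summands of \<open>img i x\<close> are orthogonal, so both vanish. Then
  \<open>F i b *v x\<close> is both parallel and orthogonal to \<open>e i\<close>, hence zero, and
  \<open>x\<close> is a multiple of \<open>e b\<close> orthogonal to \<open>e b\<close>.\<close>

lemma img_eq_0:
  assumes i: "i \<in> I" and 0: "img i x = 0"
  shows "x = 0"
proof (cases "i = b")
  case False
  let ?u = "F i b *v x"
  have eq: "e i \<times> ?u + (e b \<bullet> x) *\<^sub>R e i = 0"
    using 0 False by (simp add: img_def)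
  then have "e i \<bullet> (e i \<times> ?u + (e b \<bullet> x) *\<^sub>R e i) = 0" by simp
  then have x: "e b \<bullet> x = 0"
    by (simp add: inner_add_right dot_cross_self unit i)
  then have "e i \<times> ?u = 0" using eq by simp
  then have "?u \<times> e i = 0" using cross_skew[of ?u "e i"] by simp
  then obtain a where a: "?u = a *\<^sub>R e i"
    using cross_eq_0_parallel e_nonzero[OF i] by metis
  have "e i \<bullet> ?u = 0"
    by (rule inner_F_e[OF i base False])
  then have "?u = 0" using a unit[OF i] by simp
  then obtain s where "x = s *\<^sub>R e b"
    using fundamental_kernel_multiple[OF fundamental[OF i base False] F_e[OF base i] e_nonzero[OF base]] False
    by metis
  then show ?thesis using x unit[OF base] by simp
qed (use 0 in \<open>simp add: img_def\<close>)

text \<open>Summands along the epipoles drop out. If one view is \<open>b\<close>, the rest is the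
  inner product of \<open>y\<close> with \<open>e k \<times> y\<close>; otherwise it is the identity
  of the triple \<open>b\<close>, \<open>i\<close>, \<open>j\<close>.\<close>

lemma img_form:
  assumes ij: "i \<in> I" "j \<in> I" "i \<noteq> j"
  shows "img i x \<bullet> (F i j *v img j x) = 0"
proof -
  have fwd: "x \<bullet> (F b k *v img k x) = 0" if "k \<in> I" "k \<noteq> b" for k
  proof -
    have "F b k *v img k x = F b k *v (e k \<times> (F k b *v x))"
      using F_e[of k b] base that
      by (simp add: img_def matrix_vector_right_distrib matrix_vector_mult_scaleR)
    then have "x \<bullet> (F b k *v img k x) = (F k b *v x) \<bullet> (e k \<times> (F k b *v x))"
      using transpose_F[of b k] base that by (simp add: dot_transpose[of x])
    then show ?thesis by (simp add: dot_cross_self)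
  qed
  consider "i = b" | "j = b" | "i \<noteq> b" "j \<noteq> b" by blast
  then show ?thesis
  proof cases
    case 1
    then show ?thesis using fwd[of j] ij by (simp add: img_def)
  next
    case 2
    have "img i x \<bullet> (F i b *v x) = x \<bullet> (F b i *v img i x)"
      using transpose_F[of b i] ij base 2 by (metis dot_transpose inner_commute)
    then show ?thesis using fwd[of i] ij 2 by (simp add: img_def)
  next
    case 3
    have "F i j *v img j x = F i j *v (e j \<times> (F j b *v x))"
      using F_e[of j i] ij 3
      by (simp add: img_def matrix_vector_right_distrib matrix_vector_mult_scaleR)
    then show ?thesis
      using triple_form[OF ij 3] 3 by (simp add: img_def inner_add_left inner_F_e ij)
  qed
qed

lemma reconstruction_exists: "\<exists>P. reconstruction I F P"
proof -
  define pr where "pr X = (vector [X$1, X$2, X$3] :: real^3)" for X :: "real^4"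
  have linpr: "linear pr"
    by (rule linearI) (simp_all add: pr_def vec_eq_iff forall_3)
  define p where "p i X = img i (pr X) + (real i * X$4) *\<^sub>R e i" for i X
  have "linear (p i)" for i
    unfolding p_def using linear_img[of i] linpr
    by (intro linearI) (simp_all add: linear_add linear_scale algebra_simps)
  define P where "P i = matrix (p i)" for i
  have P: "P i *v X = p i X" for i X
    by (simp add: P_def matrix_works linear_matrix_vector_mul_eq \<open>linear (p i)\<close>)
  have p': "p i X = img i (pr X + (real i * X$4) *\<^sub>R e b)" if "i \<in> I" for i X
    using that linear_img[of i] by (simp add: p_def linear_add linear_scale img_base_epipole)
  have "camera (P i)" if i: "i \<in> I" for i
  proof (rule cameraI)
    fix y
    have "inj (img i)"
      using linear_injective_0[OF linear_img] img_eq_0[OF i] by blast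
    then obtain x where "img i x = y"
      using linear_injective_imp_surjective[OF linear_img] by (metis surjD)
    moreover have "P i *v vector [x$1, x$2, x$3, 0] = img i x"
    proof -
      have "pr (vector [x$1, x$2, x$3, 0]) = x"
        by (simp add: pr_def vec_eq_iff forall_3 vector_4_nth)
      then show ?thesis by (simp add: P p_def vector_4_nth)
    qed
    ultimately show "\<exists>X. P i *v X = y" by blast
  qed
  moreover have "view_pair (F i j) (P i) (P j)" if ij: "i \<in> I" "j \<in> I" "i \<noteq> j" for i j
    unfolding view_pair_def P
  proof (intro conjI allI impI)
    fix X
    have "F i j *v p j X = F i j *v img j (pr X)"
      using F_e[of j i] ij by (simp add: p_def matrix_vector_right_distrib matrix_vector_mult_scaleR)
    then show "p i X \<bullet> (F i j *v p j X) = 0"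
      using img_form[OF ij] by (simp add: p_def[of i] inner_add_left inner_F_e ij)
  next
    \<comment> \<open>Injectivity of \<open>img\<close> turns both conditions into equations along
      \<open>e b\<close>; since \<open>i\<close> and \<open>j\<close> differ, comparing them forces
      the fourth coordinate to be zero.\<close>
    fix X assume "p i X = 0" "p j X = 0"
    then have i: "pr X + (real i * X$4) *\<^sub>R e b = 0" and j: "pr X + (real j * X$4) *\<^sub>R e b = 0"
      using p' img_eq_0 ij by metis+
    then have "(real i * X$4) *\<^sub>R e b = (real j * X$4) *\<^sub>R e b"
      by (metis add_left_cancel)
    then have X4: "X$4 = 0"
      using e_nonzero[OF base] ij by simp
    then have "pr X = 0" using i by simp
    then show "X = 0"
      using X4 by (simp add: pr_def vec_eq_iff forall_3 forall_4)
  qed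
  ultimately show ?thesis
    unfolding reconstruction_def by blast
qed

end

section \<open>From compatibility to reconstructions, and the case distinction on epipoles\<close>

theorem theorem3p15:
  fixes n :: nat and F :: "nat \<Rightarrow> nat \<Rightarrow> real^3^3"
  assumes "n \<ge> 4"
    and "\<forall>(i, j)\<in>complete_pairs n. fundamental_matrix (F i j)"
    and "\<forall>(i, j)\<in>complete_pairs n. F j i = transpose (F i j)"
  shows "((\<forall>i\<in>{1..n}. \<forall>j\<in>{1..n}. \<forall>k\<in>{1..n}. \<forall>l\<in>{1..n}. distinct [i, j, k, l] \<longrightarrow>
             compatible {(i, j), (i, k), (j, k), (i, l), (j, l), (k, l)} F)
           \<longrightarrow> compatible (complete_pairs n) F) \<and>
         ((\<forall>i\<in>{1..n}. \<forall>j\<in>{1..n}. \<forall>k\<in>{1..n}. j \<noteq> i \<longrightarrow> k \<noteq> i \<longrightarrow>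
             epipole F j i = epipole F k i)
           \<longrightarrow> (\<forall>i\<in>{1..n}. \<forall>j\<in>{1..n}. \<forall>k\<in>{1..n}. distinct [i, j, k] \<longrightarrow>
             compatible {(i, j), (i, k), (j, k)} F)
           \<longrightarrow> compatible (complete_pairs n) F \<and>
               (\<forall>P. solution (complete_pairs n) F P \<longrightarrow>
                  (\<exists>L. projective_line L \<and> (\<forall>i\<in>{1..n}. center (P i) \<subseteq> L))))"
proof -
  let ?I = "{1..n}"
  have fam: "fundamental_matrix (F i j) \<and> transpose (F i j) = F j i"
    if "i \<in> ?I" "j \<in> ?I" "i \<noteq> j" for i j
  proof (cases "i < j")
    case True
    then have "(i, j) \<in> complete_pairs n"
      using that by (simp add: complete_pairs_def)
    then show ?thesis using assms(2,3) by auto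
  next
    case False
    then have "(j, i) \<in> complete_pairs n"
      using that by (simp add: complete_pairs_def)
    then have "fundamental_matrix (F j i)" "F i j = transpose (F j i)"
      using assms(2,3) by auto
    then show ?thesis by (simp add: fundamental_transpose)
  qed
  interpret fundamental_family ?I F
    by standard (use fam in auto)
  have "Field (complete_pairs n) = ?I"
  proof
    show "Field (complete_pairs n) \<subseteq> ?I"
      by (auto simp: Field_def complete_pairs_def)
    \<comment> \<open>Index \<open>n\<close> occurs in the pair \<open>(1, n)\<close>, every smaller
      index \<open>i\<close> in \<open>(i, n)\<close>.\<close>
    have "i \<in> Field (complete_pairs n)" if "i \<in> ?I" for i
    proof (cases "i = n")
      case True
      then have "(1, i) \<in> complete_pairs n" using assms(1) by (simp add: complete_pairs_def)
      then show ?thesis by (rule FieldI2)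
    next
      case False
      then have "(i, n) \<in> complete_pairs n" using that by (simp add: complete_pairs_def)
      then show ?thesis by (rule FieldI1)
    qed
    then show "?I \<subseteq> Field (complete_pairs n)" by blast
  qed
  then have sol: "solution (complete_pairs n) F P \<longleftrightarrow> reconstruction ?I F P" for P
    by (rule solution_iff_reconstruction) (auto simp: complete_pairs_def)
  have quad: "compatible {(i, j), (i, k), (j, k), (i, l), (j, l), (k, l)} F \<longleftrightarrow>
      (\<exists>P. reconstruction {i, j, k, l} F P)"
    if "distinct [i, j, k, l]" "{i, j, k, l} \<subseteq> ?I" for i j k l
  proof -
    have "solution {(i, j), (i, k), (j, k), (i, l), (j, l), (k, l)} F P \<longleftrightarrow> reconstruction {i, j, k, l} F P" for P
      by (rule solution_iff_reconstruction) (use that in \<open>auto simp: Field_def\<close>)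
    then show ?thesis by (simp add: compatible_def)
  qed
  have triple: "compatible {(i, j), (i, k), (j, k)} F \<longleftrightarrow> (\<exists>P. reconstruction {i, j, k} F P)"
    if "distinct [i, j, k]" "{i, j, k} \<subseteq> ?I" for i j k
  proof -
    have "solution {(i, j), (i, k), (j, k)} F P \<longleftrightarrow> reconstruction {i, j, k} F P" for P
      by (rule solution_iff_reconstruction) (use that in \<open>auto simp: Field_def\<close>)
    then show ?thesis by (simp add: compatible_def)
  qed
  have coincident: "\<exists>P. reconstruction ?I F P"
    if co: "\<And>i j k. i \<in> ?I \<Longrightarrow> j \<in> ?I \<Longrightarrow> k \<in> ?I \<Longrightarrow> j \<noteq> i \<Longrightarrow> k \<noteq> i \<Longrightarrow> epipole F j i = epipole F k i"
      and tr: "\<And>i j k. distinct [i, j, k] \<Longrightarrow> {i, j, k} \<subseteq> ?I \<Longrightarrow> \<exists>P. reconstruction {i, j, k} F P"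
  proof -
    have "\<exists>e. e \<bullet> e = 1 \<and> (\<forall>j\<in>?I. i \<noteq> j \<longrightarrow> F j i *v e = 0)" if i: "i \<in> ?I" for i
    proof -
      \<comment> \<open>Any index other than \<open>i\<close> would do: all epipoles in image
        \<open>i\<close> agree.\<close>
      define k where "k = (if i = 1 then 2 else 1 :: nat)"
      have k: "k \<in> ?I" "k \<noteq> i" using assms(1) by (auto simp: k_def)
      obtain e where e: "e \<noteq> 0" "F k i *v e = 0"
        using fundamental_kernel[OF fundamental[OF k(1) i k(2)]] by metis
      have "(inverse (norm e) *\<^sub>R e) \<bullet> (inverse (norm e) *\<^sub>R e) = 1"
        using e(1) by (simp add: dot_square_norm power2_eq_square)
      moreover have "F j i *v (inverse (norm e) *\<^sub>R e) = 0" if "j \<in> ?I" "i \<noteq> j" for j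
      proof -
        have "e \<in> epipole F j i"
          using co[OF i that(1) k(1)] that k e unfolding epipole_def by auto
        then show ?thesis by (simp add: epipole_def matrix_vector_mult_scaleR)
      qed
      ultimately show ?thesis by blast
    qed
    then obtain e where e: "\<And>i. i \<in> ?I \<Longrightarrow> e i \<bullet> e i = 1"
      "\<And>i j. i \<in> ?I \<Longrightarrow> j \<in> ?I \<Longrightarrow> i \<noteq> j \<Longrightarrow> F j i *v e i = 0"
      by metis
    interpret coincident_epipoles ?I F 1 e
      by standard (use assms(1) e tr in auto)
    show ?thesis by (rule reconstruction_exists)
  qed
  have part1: "\<exists>P. reconstruction ?I F P"
    if q: "\<And>i j k l. distinct [i, j, k, l] \<Longrightarrow> {i, j, k, l} \<subseteq> ?I \<Longrightarrow> \<exists>P. reconstruction {i, j, k, l} F P"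
  proof -
    \<comment> \<open>As \<open>n \<ge> 4\<close>, a triple extends to a quadruple, whose
      reconstruction is restricted.\<close>
    have tr: "\<exists>P. reconstruction {i, j, k} F P" if "distinct [i, j, k]" "{i, j, k} \<subseteq> ?I" for i j k
    proof -
      have "card {i, j, k} < card ?I"
        using that(1) assms(1) by simp
      then have "\<not> ?I \<subseteq> {i, j, k}"
        using card_mono[of "{i, j, k}" ?I] by auto
      then obtain l where "l \<in> ?I" "l \<notin> {i, j, k}" by blast
      then have "\<exists>P. reconstruction {i, j, k, l} F P"
        using that by (intro q) auto
      then obtain P where "reconstruction {i, j, k, l} F P" ..
      then have "reconstruction {i, j, k} F P"
        by (rule reconstruction_subset) auto
      then show ?thesis by blast
    qed
    show ?thesis
    proof (cases "\<forall>i\<in>?I. \<forall>j\<in>?I. \<forall>k\<in>?I. j \<noteq> i \<longrightarrow> k \<noteq> i \<longrightarrow> epipole F j i = epipole F k i")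
      case True
      show ?thesis
        by (rule coincident[OF True[rule_format] tr])
    next
      case False
      then obtain i j k where ijk: "i \<in> ?I" "j \<in> ?I" "k \<in> ?I" "j \<noteq> i" "k \<noteq> i"
        and ne: "epipole F j i \<noteq> epipole F k i" by blast
      \<comment> \<open>\<open>j \<noteq> k\<close> because the two epipoles differ.\<close>
      then have d: "i \<noteq> j" "i \<noteq> k" "j \<noteq> k" "{i, j, k} \<subseteq> ?I" by auto
      then obtain R where R: "reconstruction {i, j, k} F R" using tr[of i j k] by auto
      show ?thesis
        by (rule glue_noncollinear[OF q R d noncollinear_of_epipoles[OF R d ne]])
    qed
  qed
  have line: "\<exists>L. projective_line L \<and> (\<forall>i\<in>?I. center (P i) \<subseteq> L)"
    if co: "\<forall>i\<in>?I. \<forall>j\<in>?I. \<forall>k\<in>?I. j \<noteq> i \<longrightarrow> k \<noteq> i \<longrightarrow> epipole F j i = epipole F k i"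
      and P: "reconstruction ?I F P" for P
  proof (rule collinear_centers[OF P])
    show "1 \<in> ?I" "2 \<in> ?I" "1 \<noteq> (2 :: nat)"
      using assms(1) by auto
  qed (rule co[rule_format])
  show ?thesis
    unfolding compatible_def[of "complete_pairs n"] sol
  proof (intro conjI impI allI)
    assume q: "\<forall>i\<in>?I. \<forall>j\<in>?I. \<forall>k\<in>?I. \<forall>l\<in>?I. distinct [i, j, k, l] \<longrightarrow>
      compatible {(i, j), (i, k), (j, k), (i, l), (j, l), (k, l)} F"
    show "\<exists>P. reconstruction ?I F P"
    proof (rule part1)
      fix i j k l assume d: "distinct [i, j, k, l]" "{i, j, k, l} \<subseteq> ?I"
      then have "i \<in> ?I" "j \<in> ?I" "k \<in> ?I" "l \<in> ?I" by auto
      then show "\<exists>P. reconstruction {i, j, k, l} F P"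
        using q d(1) unfolding quad[OF d, symmetric] by blast
    qed
  next
    assume co: "\<forall>i\<in>?I. \<forall>j\<in>?I. \<forall>k\<in>?I. j \<noteq> i \<longrightarrow> k \<noteq> i \<longrightarrow> epipole F j i = epipole F k i"
      and t: "\<forall>i\<in>?I. \<forall>j\<in>?I. \<forall>k\<in>?I. distinct [i, j, k] \<longrightarrow> compatible {(i, j), (i, k), (j, k)} F"
    show "\<exists>P. reconstruction ?I F P"
    proof (rule coincident[OF co[rule_format]])
      fix i j k assume d: "distinct [i, j, k]" "{i, j, k} \<subseteq> ?I"
      then have "i \<in> ?I" "j \<in> ?I" "k \<in> ?I" by auto
      then show "\<exists>P. reconstruction {i, j, k} F P"
        using t d(1) unfolding triple[OF d, symmetric] by blast
    qed
  qed (rule line)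
qed

end
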